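(* Let $G=(V,E)$ be a locally finite graph with positive edge weights satisfying $w_{xy}=w_{yx}$ for all $y\sim x\in V$, and with measure satisfying $\mu(x)\ge\mu_{\min}>0$ for all $x\in V$, where $\mu_{\min}$ is a constant. Let $h:V\to\mathbb{R}$ be a function such that (i) there exists a constant $h_0>0$ with $h(x)\ge h_0$ for all $x\in V$; (ii) $1/h\in L^1(V)$. Let $f:V\times\mathbb{R}\to\mathbb{R}$ satisfy, with $F(x,s)=\int_0^s f(x,t)\,dt$: (a) $f(x,s)$ is continuous in $s$, $f(x,0)=0$ for all $x\in V$, and for every $M>0$ there exists a constant $A_M$ such that $\max_{s\in[0,M]}f(x,s)\le A_M$ for all $x\in V$; (b) there exists a constant $\theta>2$ such that $0<\theta F(x,s)\le s f(x,s)$ for all $x\in V$ and $s>0$; (c) for all $x\in V$, $\limsup_{s\to0+}\frac{2F(x,s)}{s^2}<\lambda_1$, where $\lambda_1=\inf_{\int_V u^2d\mu=1}\int_V(|\nabla u|^2+hu^2)\,d\mu$. Suppose that $g\in\mathscr{H}'$ satisfies $g(x)\ge0$ for all $x\in V$ and $g\not\equiv0$. Then there exists a constant $\epsilon_0>0$ such that for any $0<\epsilon<\epsilon_0$ the equation $-\Delta u+hu=f(x,u)+\epsilon g$ on $V$ has two distinct strictly positive solutions (functions $u:V\to\mathbb{R}$ with $u(x)>0$ satisfying the equation at every $x\in V$).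
   Context: $G=(V,E)$ is a graph with vertex set $V$ and edge set $E$; $y\sim x$ means $xy\in E$. Locally finite means each $x\in V$ has only finitely many $y$ with $xy\in E$. Each edge $xy$ carries a weight $w_{xy}>0$. The measure is a function $\mu:V\to(0,\infty)$, and $\int_V g\,d\mu=\sum_{x\in V}\mu(x)g(x)$; $L^q(V)$ is taken with respect to $\mu$. The Laplacian is $\Delta u(x)=\frac{1}{\mu(x)}\sum_{y\sim x}w_{xy}(u(y)-u(x))$, and $|\nabla u|(x)=\left(\frac{1}{2\mu(x)}\sum_{y\sim x}w_{xy}(u(y)-u(x))^2\right)^{1/2}$. $C_c(V)$ is the set of finitely supported functions on $V$; $W^{1,2}(V)$ is the completion of $C_c(V)$ under $\|u\|_{W^{1,2}(V)}=\left(\int_V(|\nabla u|^2+u^2)d\mu\right)^{1/2}$ (regarded as a space of functions on $V$). $\mathscr{H}=\{u\in W^{1,2}(V):\int_V hu^2d\mu<+\infty\}$ with norm $\|u\|_{\mathscr{H}}=\left(\int_V(|\nabla u|^2+hu^2)d\mu\right)^{1/2}$, a Hilbert space; the infimum defining $\lambda_1$ is over $u\in\mathscr{H}$ with $\int_Vu^2d\mu=1$. $\mathscr{H}'$ is the dual of $\mathscr{H}$; a function $g:V\to\mathbb{R}$ belongs to $\mathscr{H}'$ if $\varphi\mapsto\int_Vg\varphi\,d\mu$, $\varphi\in C_c(V)$, is bounded for the norm $\|\cdot\|_{\mathscr{H}}$, and $g$ is then identified with the continuous extension of this functional to $\mathscr{H}$ ($C_c(V)$ is dense in $\mathscr{H}$).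 *)

theory Defs
  imports "HOL-Analysis.Analysis"
begin

text \<open>
  The vertex set is the whole type \<open>'v\<close> and \<open>E x y\<close> states that \<open>xy\<close> is an edge.
  The weight \<open>w x y\<close> is only ever read at pairs with \<open>E x y\<close>. Loops are not excluded; they
  contribute \<open>0\<close> to the Laplacian and to the gradient.
\<close>

definition locally_finite_graph :: "('v \<Rightarrow> 'v \<Rightarrow> bool) \<Rightarrow> bool" where
  "locally_finite_graph E \<longleftrightarrow> symp E \<and> (\<forall>x. finite {y. E x y})"

definition laplacian ::
  "('v \<Rightarrow> 'v \<Rightarrow> bool) \<Rightarrow> ('v \<Rightarrow> 'v \<Rightarrow> real) \<Rightarrow> ('v \<Rightarrow> real) \<Rightarrow> ('v \<Rightarrow> real) \<Rightarrow> 'v \<Rightarrow> real" where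
  "laplacian E w \<mu> u x = (1 / \<mu> x) * (\<Sum>y | E x y. w x y * (u y - u x))"

definition grad_length ::
  "('v \<Rightarrow> 'v \<Rightarrow> bool) \<Rightarrow> ('v \<Rightarrow> 'v \<Rightarrow> real) \<Rightarrow> ('v \<Rightarrow> real) \<Rightarrow> ('v \<Rightarrow> real) \<Rightarrow> 'v \<Rightarrow> real" where
  "grad_length E w \<mu> u x = sqrt (1 / (2 * \<mu> x) * (\<Sum>y | E x y. w x y * (u y - u x)\<^sup>2))"

definition in_L1 :: "('v \<Rightarrow> real) \<Rightarrow> ('v \<Rightarrow> real) \<Rightarrow> bool" where
  "in_L1 \<mu> g \<longleftrightarrow> (\<lambda>x. \<bar>\<mu> x * g x\<bar>) summable_on UNIV"

text \<open>
  \<^const>\<open>infsum\<close> is \<open>0\<close> on non-summable families. Below, \<open>vint\<close> is applied only to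
  finitely supported functions and to functions that are summable for every \<open>u\<close> in the space
  \<open>H_space\<close>, except in the constraint \<open>vint \<mu> (\<lambda>x. (u x)\<^sup>2) = 1\<close>, which forces summability.
\<close>

definition vint :: "('v \<Rightarrow> real) \<Rightarrow> ('v \<Rightarrow> real) \<Rightarrow> real" where
  "vint \<mu> g = (\<Sum>\<^sub>\<infinity>x. \<mu> x * g x)"

definition Cc :: "('v \<Rightarrow> real) set" where
  "Cc = {u. finite {x. u x \<noteq> 0}}"

definition W12_norm ::
  "('v \<Rightarrow> 'v \<Rightarrow> bool) \<Rightarrow> ('v \<Rightarrow> 'v \<Rightarrow> real) \<Rightarrow> ('v \<Rightarrow> real) \<Rightarrow> ('v \<Rightarrow> real) \<Rightarrow> real" where
  "W12_norm E w \<mu> u = sqrt (vint \<mu> (\<lambda>x. (grad_length E w \<mu> u x)\<^sup>2 + (u x)\<^sup>2))"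

text \<open>
  The completion of \<open>Cc\<close> as a space of functions: as \<open>\<mu> > 0\<close>, a Cauchy sequence in the
  \<open>W12_norm\<close> converges pointwise, and its class in the completion is identified with the
  pointwise limit.
\<close>

definition W12 ::
  "('v \<Rightarrow> 'v \<Rightarrow> bool) \<Rightarrow> ('v \<Rightarrow> 'v \<Rightarrow> real) \<Rightarrow> ('v \<Rightarrow> real) \<Rightarrow> ('v \<Rightarrow> real) set" where
  "W12 E w \<mu> = {u. \<exists>\<phi> :: nat \<Rightarrow> 'v \<Rightarrow> real.
      (\<forall>n. \<phi> n \<in> Cc) \<and>
      (\<forall>e>0. \<exists>N. \<forall>m\<ge>N. \<forall>n\<ge>N. W12_norm E w \<mu> (\<lambda>x. \<phi> m x - \<phi> n x) < e) \<and>
      (\<forall>x. (\<lambda>n. \<phi> n x) \<longlonglongrightarrow> u x)}"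

definition H_space ::
  "('v \<Rightarrow> 'v \<Rightarrow> bool) \<Rightarrow> ('v \<Rightarrow> 'v \<Rightarrow> real) \<Rightarrow> ('v \<Rightarrow> real) \<Rightarrow> ('v \<Rightarrow> real) \<Rightarrow> ('v \<Rightarrow> real) set" where
  "H_space E w \<mu> h = {u \<in> W12 E w \<mu>. in_L1 \<mu> (\<lambda>x. h x * (u x)\<^sup>2)}"

definition H_norm ::
  "('v \<Rightarrow> 'v \<Rightarrow> bool) \<Rightarrow> ('v \<Rightarrow> 'v \<Rightarrow> real) \<Rightarrow> ('v \<Rightarrow> real) \<Rightarrow> ('v \<Rightarrow> real) \<Rightarrow> ('v \<Rightarrow> real) \<Rightarrow> real" where
  "H_norm E w \<mu> h u = sqrt (vint \<mu> (\<lambda>x. (grad_length E w \<mu> u x)\<^sup>2 + h x * (u x)\<^sup>2))"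

definition lambda1 ::
  "('v \<Rightarrow> 'v \<Rightarrow> bool) \<Rightarrow> ('v \<Rightarrow> 'v \<Rightarrow> real) \<Rightarrow> ('v \<Rightarrow> real) \<Rightarrow> ('v \<Rightarrow> real) \<Rightarrow> real" where
  "lambda1 E w \<mu> h =
     (INF u \<in> {u \<in> H_space E w \<mu> h. vint \<mu> (\<lambda>x. (u x)\<^sup>2) = 1}.
        vint \<mu> (\<lambda>x. (grad_length E w \<mu> u x)\<^sup>2 + h x * (u x)\<^sup>2))"

definition in_H_dual ::
  "('v \<Rightarrow> 'v \<Rightarrow> bool) \<Rightarrow> ('v \<Rightarrow> 'v \<Rightarrow> real) \<Rightarrow> ('v \<Rightarrow> real) \<Rightarrow> ('v \<Rightarrow> real) \<Rightarrow> ('v \<Rightarrow> real) \<Rightarrow> bool" where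
  "in_H_dual E w \<mu> h g \<longleftrightarrow>
     (\<exists>C. \<forall>\<phi>\<in>Cc. \<bar>vint \<mu> (\<lambda>x. g x * \<phi> x)\<bar> \<le> C * H_norm E w \<mu> h \<phi>)"

definition primitive :: "('v \<Rightarrow> real \<Rightarrow> real) \<Rightarrow> 'v \<Rightarrow> real \<Rightarrow> real" where
  "primitive f x s = (LBINT t=0..s. f x t)"

definition is_positive_solution ::
  "('v \<Rightarrow> 'v \<Rightarrow> bool) \<Rightarrow> ('v \<Rightarrow> 'v \<Rightarrow> real) \<Rightarrow> ('v \<Rightarrow> real) \<Rightarrow> ('v \<Rightarrow> real) \<Rightarrow>
   ('v \<Rightarrow> real \<Rightarrow> real) \<Rightarrow> ('v \<Rightarrow> real) \<Rightarrow> real \<Rightarrow> ('v \<Rightarrow> real) \<Rightarrow> bool" where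
  "is_positive_solution E w \<mu> h f g \<epsilon> u \<longleftrightarrow>
     (\<forall>x. u x > 0 \<and> - laplacian E w \<mu> u x + h x * u x = f x (u x) + \<epsilon> * g x)"

end

theory Submission
  imports Defs "HOL-Complex_Analysis.Great_Picard"
begin

text \<open>
  The energy of a function supported in a finite vertex set \<open>S\<close> is a function of finitely many real
  variables. Condition (b) makes \<open>F x s / s powr \<theta>\<close> nondecreasing in \<open>s\<close>, so \<open>F x s \<le> A * s powr \<theta>\<close>
  for \<open>s \<le> 1\<close> with \<open>A\<close> independent of \<open>x\<close>. Hence the energy is at least \<open>r\<^sup>2 / 8\<close> on the sphere
  of a radius \<open>r\<close> independent of \<open>S\<close> and of small \<open>\<epsilon>\<close>, and it has on \<open>S\<close> a critical point of
  mountain pass type above that level and a minimum over the ball at level at most \<open>0\<close>.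
  Condition (b) bounds both uniformly in \<open>S\<close>; along an exhaustion by finite sets they converge
  pointwise to solutions.

  At a critical point the energy equals \<open>\<Sum>\<mu>(u f(u) / 2 - F(u))\<close> up to half of the linear term, and this
  nonnegative sum separates the two limits: since \<open>1 / h\<close> is summable, the tails of the sum are
  uniformly small on the mountain pass points, so no mass is lost, whereas for the minima finite
  partial sums stay small.

  The graph may be disconnected, and a solution can vanish on components where \<open>g = 0\<close>.
  Mountain pass solutions exist on each component separately and are positive there, so they are
  used on all components but one with \<open>g \<noteq> 0\<close>, where both solutions are positive.
\<close>

subsection \<open>A finite-dimensional mountain pass theorem\<close>

text \<open>A ball of functions supported in \<open>S\<close>, kept inside the full function type:
  its product topology is the Euclidean one when \<open>S\<close> is finite, so no separate
  finite-dimensional type is needed.\<close>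

definition fball :: "'v set \<Rightarrow> real \<Rightarrow> ('v \<Rightarrow> real) set" where
  "fball S R = {u. (\<forall>x. x \<notin> S \<longrightarrow> u x = 0) \<and> L2_set u S \<le> R}"

lemma continuous_on_L2_set:
  assumes "\<And>x. x \<in> S \<Longrightarrow> continuous_on A (\<lambda>u. h u x)"
  shows "continuous_on A (\<lambda>u. L2_set (h u) S)"
  unfolding L2_set_def using assms by (intro continuous_intros) auto

lemma L2_set_minus_commute: "L2_set (\<lambda>x. u x - v x) S = L2_set (\<lambda>x. v x - u x) S"
  unfolding L2_set_def by (simp add: power2_commute)

lemma sum_mult_le_L2_set: "(\<Sum>x\<in>S. u x * v x) \<le> L2_set u S * L2_set v S"
proof -
  have "(\<Sum>x\<in>S. u x * v x) \<le> (\<Sum>x\<in>S. \<bar>u x\<bar> * \<bar>v x\<bar>)"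
    by (intro sum_mono) (metis abs_ge_self abs_mult)
  then show ?thesis using L2_set_mult_ineq[of u v S] by linarith
qed

lemma L2_set_power2: "(L2_set u S)\<^sup>2 = (\<Sum>x\<in>S. (u x)\<^sup>2)"
  unfolding L2_set_def by (simp add: sum_nonneg)

lemma abs_le_L2_set: "finite S \<Longrightarrow> x \<in> S \<Longrightarrow> \<bar>u x\<bar> \<le> L2_set u S"
  using member_le_L2_set[of S x "\<lambda>x. \<bar>u x\<bar>"] by (simp add: L2_set_def)

text \<open>By Tychonoff: a closed subset of a product of compact intervals, the factors off
  \<open>S\<close> being the point 0.\<close>

lemma compact_fball:
  assumes "finite S"
  shows "compact (fball S R)"
proof -
  define I where "I = (\<lambda>x. if x \<in> S then {-R..R} else {0::real})"
  have "compactin (product_topology (\<lambda>i. euclidean) UNIV) (PiE UNIV I)"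
    unfolding compactin_PiE by (auto simp: I_def)
  then have I: "compact (PiE UNIV I)"
    by (simp add: euclidean_product_topology)
  have "closed ({u. L2_set u S \<le> R})"
    by (intro closed_Collect_le continuous_on_L2_set continuous_on_product_coordinates continuous_on_const)
  then have "compact ({u. L2_set u S \<le> R} \<inter> PiE UNIV I)"
    by (metis I compact_Int_closed inf_commute)
  moreover have "fball S R = {u. L2_set u S \<le> R} \<inter> PiE UNIV I"
  proof -
    have "u x \<in> I x" if "u \<in> fball S R" for u x
      using abs_le_L2_set[OF assms, of x u] that by (auto simp: fball_def I_def)
    moreover have "u \<in> fball S R" if "u \<in> PiE UNIV I" "L2_set u S \<le> R" for u
    proof -
      have "u x = 0" if "x \<notin> S" for x
        using PiE_mem[OF \<open>u \<in> PiE UNIV I\<close>, of x] that by (auto simp: I_def)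
      then show ?thesis using that by (auto simp: fball_def)
    qed
    ultimately show ?thesis by (auto simp: fball_def)
  qed
  ultimately show ?thesis by simp
qed

text \<open>Used to cut a path off at its first exit from a ball. The first hitting time is the
  infimum of the closed set of hitting times; an earlier excess over \<open>R\<close> would force an
  earlier hit.\<close>

lemma first_hit:
  fixes n :: "real \<Rightarrow> real"
  assumes "continuous_on {0..1} n" "n 0 < R" "R \<le> n 1"
  obtains t where "t \<in> {0..1}" "n t = R" "\<And>s. s \<in> {0..t} \<Longrightarrow> n s \<le> R"
proof -
  define T where "T = {t \<in> {0..1}. n t = R}"
  have ne: "T \<noteq> {}"
    using IVT'[of n 0 R 1] assms by (force simp: T_def)
  have "closed T"
    unfolding T_def using assms(1) by (intro continuous_closed_preimage_constant) auto
  then have T: "Inf T \<in> T"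
    using ne by (intro closed_contains_Inf) (auto simp: T_def intro!: bdd_belowI[of _ 0])
  show ?thesis
  proof (rule that[of "Inf T"])
    show "Inf T \<in> {0..1}" "n (Inf T) = R" using T by (auto simp: T_def)
    fix s assume s: "s \<in> {0..Inf T}"
    show "n s \<le> R"
    proof (rule ccontr)
      assume gt: "\<not> n s \<le> R"
      have "s \<le> 1" using s T by (auto simp: T_def)
      then have "continuous_on {0..s} n"
        using assms(1) continuous_on_subset by (metis atLeastatMost_subset_iff order_refl)
      then obtain x where x: "0 \<le> x" "x \<le> s" "n x = R"
        using IVT'[of n 0 R s] assms(2) gt s by auto
      then have "x \<in> T" using \<open>s \<le> 1\<close> by (auto simp: T_def)
      then have "Inf T \<le> x" by (intro cInf_lower) (auto simp: T_def intro!: bdd_belowI[of _ 0])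
      then have "x = s" using x s by auto
      then show False using gt x by auto
    qed
  qed
qed

text \<open>
  The minimax level is taken over paths from \<open>0\<close> to the sphere that stay inside the ball. Because
  \<open>-G\<close> points out of the ball on the relevant part of the sphere, a single Euler step along a
  normalised \<open>-G\<close>, cut off at the first exit from the ball, maps such paths to such paths; no flow
  is needed.
\<close>

lemma finite_mountain_pass:
  fixes J q :: "('v \<Rightarrow> real) \<Rightarrow> real" and G :: "('v \<Rightarrow> real) \<Rightarrow> 'v \<Rightarrow> real"
  assumes S: "finite S" "x0 \<in> S" and R: "R > 0"
    and J: "continuous_on UNIV J"
    and G: "\<And>x. x \<in> S \<Longrightarrow> continuous_on UNIV (\<lambda>u. G u x)"
    and diff: "\<And>\<eta>. \<eta> > 0 \<Longrightarrow> \<exists>\<tau>>0. \<forall>u\<in>fball S R. \<forall>v. (\<forall>x. x \<notin> S \<longrightarrow> v x = 0) \<longrightarrow>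
        L2_set (\<lambda>x. v x - u x) S \<le> \<tau> \<longrightarrow>
        J v \<le> J u + (\<Sum>x\<in>S. G u x * (v x - u x)) + \<eta> * L2_set (\<lambda>x. v x - u x) S"
    and outward: "\<And>u. u \<in> fball S R \<Longrightarrow> L2_set u S = R \<Longrightarrow> J u \<le> C \<Longrightarrow> (\<Sum>x\<in>S. G u x * u x) \<le> 0"
    and q: "continuous_on UNIV q" "q (\<lambda>_. 0) \<le> \<rho>"
      "\<And>u. u \<in> fball S R \<Longrightarrow> L2_set u S = R \<Longrightarrow> \<rho> \<le> q u"
      "\<And>u. u \<in> fball S R \<Longrightarrow> q u = \<rho> \<Longrightarrow> \<delta> \<le> J u"
    and J0: "J (\<lambda>_. 0) < \<delta>"
    and ray: "\<And>t. 0 \<le> t \<Longrightarrow> t \<le> R \<Longrightarrow> J (\<lambda>x. if x = x0 then t else 0) \<le> C0" "C0 < C"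
  obtains u where "u \<in> fball S R" "\<And>x. x \<in> S \<Longrightarrow> G u x = 0" "\<delta> \<le> J u" "J u \<le> C0"
proof -
  \<comment> \<open>The endpoint may be any point of the sphere, so a deformation need not fix
    it.\<close>
  define padm where "padm a \<gamma> \<longleftrightarrow> (continuous_on {0..1} \<gamma> \<and> \<gamma> 0 = (\<lambda>_. 0) \<and>
      L2_set (\<gamma> 1) S = R \<and> (\<forall>t\<in>{0..1::real}. \<gamma> t \<in> fball S R \<and> J (\<gamma> t) < a))" for a \<gamma>
  define reach where "reach a \<longleftrightarrow> (\<exists>\<gamma>. padm a \<gamma>)" for a
  define c where "c = Inf {a. reach a}"
  have reach_mono: "reach b" if "reach a" "a \<le> b" for a b
    using that unfolding reach_def padm_def by force
  \<comment> \<open>Linking: \<open>q\<close> is at most \<open>\<rho>\<close> at 0 and at least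
    \<open>\<rho>\<close> on the sphere, so every admissible path meets the set
    \<open>q u = \<rho>\<close>, where \<open>J\<close> is at least \<open>\<delta>\<close>.\<close>
  have reach_ge: "\<delta> \<le> a" if "reach a" for a
  proof -
    obtain \<gamma> where "padm a \<gamma>" using \<open>reach a\<close> unfolding reach_def by blast
    then have \<gamma>: "continuous_on {0..1} \<gamma>" "\<gamma> 0 = (\<lambda>_. 0)" "L2_set (\<gamma> 1) S = R"
      "\<forall>t\<in>{0..1::real}. \<gamma> t \<in> fball S R \<and> J (\<gamma> t) < a"
      by (simp_all add: padm_def)
    have "continuous_on {0..1} (\<lambda>t. q (\<gamma> t))"
      by (rule continuous_on_compose2[OF q(1) \<gamma>(1)]) auto
    moreover have "q (\<gamma> 0) \<le> \<rho>" "\<rho> \<le> q (\<gamma> 1)"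
      using q(2) q(3)[of "\<gamma> 1"] \<gamma>(2-4) by simp_all
    ultimately obtain t where t: "0 \<le> t" "t \<le> 1" "q (\<gamma> t) = \<rho>"
      using IVT'[of "\<lambda>t. q (\<gamma> t)" 0 \<rho> 1] by auto
    with \<gamma>(4) have "\<gamma> t \<in> fball S R" "J (\<gamma> t) < a" by simp_all
    with q(4)[of "\<gamma> t"] t show ?thesis by linarith
  qed
  \<comment> \<open>The straight segment along the coordinate \<open>x0\<close> is an admissible
    path.\<close>
  have reach_C0: "reach a" if "C0 < a" for a
    unfolding reach_def padm_def
  proof (intro exI[of _ "\<lambda>t x. if x = x0 then t * R else 0"] conjI ballI)
    show "continuous_on {0..1} (\<lambda>t x. if x = x0 then t * R else 0)"
    proof (rule continuous_on_coordinatewise_then_product)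
      show "continuous_on {0..1} (\<lambda>t. if i = x0 then t * R else 0)" for i
        by (cases "i = x0") (auto intro!: continuous_intros)
    qed
    have L: "L2_set (\<lambda>x. if x = x0 then s else 0) S = \<bar>s\<bar>" for s :: real
    proof -
      have "(\<Sum>x\<in>S. (if x = x0 then s else 0)\<^sup>2) = (\<Sum>x\<in>S. if x = x0 then s\<^sup>2 else 0)"
        by (intro sum.cong) auto
      then show ?thesis using S by (simp add: L2_set_def)
    qed
    show "L2_set (\<lambda>x. if x = x0 then 1 * R else 0) S = R" using L R by simp
    fix t :: real assume t: "t \<in> {0..1}"
    show "(\<lambda>x. if x = x0 then t * R else 0) \<in> fball S R"
      using t R S L[of "t * R"] by (auto simp: fball_def mult_left_le_one_le)
    show "J (\<lambda>x. if x = x0 then t * R else 0) < a"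
      using ray(1)[of "t * R"] t R that by (auto simp: mult_left_le_one_le)
  qed auto
  have ne: "{a. reach a} \<noteq> {}" using reach_C0[of "C0 + 1"] by auto
  have bdd: "bdd_below {a. reach a}" using reach_ge by (intro bdd_belowI) auto
  have c_ge: "\<delta> \<le> c" unfolding c_def using ne reach_ge by (intro cInf_greatest) auto
  have c_le: "c \<le> C0"
  proof (rule field_le_epsilon)
    fix e :: real assume "e > 0"
    then show "c \<le> C0 + e" unfolding c_def by (intro cInf_lower bdd) (auto intro: reach_C0)
  qed
  have not_below: "\<not> reach a" if "a < c" for a
    using that cInf_lower[OF _ bdd, of a] by (auto simp: c_def)
  show ?thesis
  proof (rule ccontr)
    assume no: "\<not> thesis"
    define N where "N u = L2_set (G u) S" for u
    have N: "continuous_on UNIV N" unfolding N_def using G by (rule continuous_on_L2_set)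
    \<comment> \<open>Compactness replaces the Palais-Smale condition: if the minimum
      \<open>m\<close> of \<open>N u + \<bar>J u - c\<bar>\<close> over the ball were 0, its
      minimiser would be the wanted critical point at level \<open>c\<close>.\<close>
    have "compact (fball S R)" by (rule compact_fball[OF S(1)])
    moreover have "(\<lambda>_. 0) \<in> fball S R" using R by (auto simp: fball_def L2_set_def)
    moreover have "continuous_on (fball S R) (\<lambda>u. N u + \<bar>J u - c\<bar>)"
      using N J by (intro continuous_intros) (auto intro: continuous_on_subset)
    ultimately obtain um where um: "um \<in> fball S R"
      "\<And>u. u \<in> fball S R \<Longrightarrow> N um + \<bar>J um - c\<bar> \<le> N u + \<bar>J u - c\<bar>"
      using continuous_attains_inf[of "fball S R" "\<lambda>u. N u + \<bar>J u - c\<bar>"] by blast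
    define m where "m = N um + \<bar>J um - c\<bar>"
    have "m > 0"
    proof (rule ccontr)
      assume "\<not> m > 0"
      moreover have "0 \<le> N um" by (simp add: N_def)
      ultimately have "N um = 0" "J um = c" by (auto simp: m_def)
      then show False
        using that[of um] um(1) c_ge c_le no L2_set_eq_0_iff[OF S(1), of "G um"] by (auto simp: N_def)
    qed
    \<comment> \<open>The first bound keeps \<open>N u\<close> at least \<open>m / 2\<close> in the
      band of width \<open>e\<close> around \<open>c\<close>, the second makes the step fix 0, and
      the third keeps the band in the range where \<open>outward\<close> applies.\<close>
    define e where "e = Min {m / 2, c - J (\<lambda>_. 0), C - c}"
    have e: "e > 0" "e \<le> m / 2" "J (\<lambda>_. 0) \<le> c - e" "c + e \<le> C"
      using \<open>m > 0\<close> J0 c_ge c_le ray(2) by (auto simp: e_def min_def)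
    define d where "d = m / 2"
    have d: "d > 0" using \<open>m > 0\<close> by (simp add: d_def)
    have N_ge: "d \<le> N u" if "u \<in> fball S R" "\<bar>J u - c\<bar> \<le> e" for u
      using um(2)[OF that(1)] that(2) e(2) unfolding m_def[symmetric] d_def by linarith
    \<comment> \<open>The error rate \<open>d / 2\<close> is half of the slope guaranteed in the
      band, so half of the first-order decrease survives.\<close>
    obtain \<tau> where \<tau>: "\<tau> > 0" and \<tau>': "\<forall>u\<in>fball S R. \<forall>v. (\<forall>x. x \<notin> S \<longrightarrow> v x = 0) \<longrightarrow>
        L2_set (\<lambda>x. v x - u x) S \<le> \<tau> \<longrightarrow>
        J v \<le> J u + (\<Sum>x\<in>S. G u x * (v x - u x)) + d / 2 * L2_set (\<lambda>x. v x - u x) S"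
      using diff[OF half_gt_zero[OF d]] by (elim exE conjE) (rule that)
    have J_step: "J v \<le> J u + (\<Sum>x\<in>S. G u x * (v x - u x)) + d / 2 * L2_set (\<lambda>x. v x - u x) S"
      if "u \<in> fball S R" "\<And>x. x \<notin> S \<Longrightarrow> v x = 0" "L2_set (\<lambda>x. v x - u x) S \<le> \<tau>" for u v
      using \<tau>'[rule_format, of u v] that by simp
    define \<psi> where "\<psi> t = max 0 (min 1 (2 * (t - c + e) / e))" for t
    have \<psi>01: "0 \<le> \<psi> t" "\<psi> t \<le> 1" for t by (auto simp: \<psi>_def)
    have \<psi>0: "\<psi> t = 0" if "t \<le> c - e" for t
      using that e(1) by (auto simp: \<psi>_def max_def min_def field_simps)
    have \<psi>1: "\<psi> t = 1" if "t \<ge> c - e / 2" for t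
      using that e(1) by (auto simp: \<psi>_def max_def min_def field_simps)
    \<comment> \<open>A step of length at most \<open>\<tau>\<close> along the normalised
      \<open>-G\<close>, switched off by \<open>\<psi>\<close> at levels below \<open>c - e\<close>.
      Using \<open>max d (N u)\<close> instead of \<open>N u\<close> keeps it continuous at zeros of
      \<open>G\<close>; in the band both agree.\<close>
    define st where "st u x = (if x \<in> S then u x - \<tau> * \<psi> (J u) / max d (N u) * G u x else 0)" for u x
    have st: "continuous_on UNIV st"
    proof (rule continuous_on_coordinatewise_then_product)
      show "continuous_on UNIV (\<lambda>u. st u x)" for x
      proof (cases "x \<in> S")
        case True
        have "continuous_on UNIV (\<lambda>u. u x - \<tau> * \<psi> (J u) / max d (N u) * G u x)"
          unfolding \<psi>_def using True d e(1) by (intro continuous_intros continuous_on_product_coordinates J N G) (auto simp: max_def)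
        then show ?thesis using True by (simp add: st_def)
      qed (simp add: st_def)
    qed
    have st_dist: "L2_set (\<lambda>x. st u x - u x) S = \<tau> * \<psi> (J u) / max d (N u) * N u" for u
    proof -
      have "L2_set (\<lambda>x. st u x - u x) S = L2_set (\<lambda>x. \<tau> * \<psi> (J u) / max d (N u) * G u x) S"
        by (subst L2_set_minus_commute) (auto simp: st_def intro!: L2_set_cong)
      also have "\<dots> = \<tau> * \<psi> (J u) / max d (N u) * N u"
        unfolding N_def using \<tau> \<psi>01 d by (subst L2_set_right_distrib) auto
      finally show ?thesis .
    qed
    \<comment> \<open>Where \<open>\<psi>\<close> is 1 the energy drops by
      \<open>\<tau> * d / 2\<close>, from at most \<open>\<tau> * d / 4\<close> above
      \<open>c\<close> to at least as much below; elsewhere it is already below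
      \<open>c - e / 2\<close> and does not increase.\<close>
    have J_st: "J (st u) \<le> max (c - e / 2) (c - \<tau> * d / 4)"
      if u: "u \<in> fball S R" "J u \<le> c + e" "J u \<le> c + \<tau> * d / 4" for u
    proof (cases "J u \<le> c - e")
      case True
      then have "st u = u" using u(1) \<psi>0 by (auto simp: st_def fball_def)
      then show ?thesis using True e(1) by auto
    next
      case False
      then have Nd: "d \<le> N u" using N_ge[OF u(1)] u(2) by auto
      have mx: "max d (N u) = N u" using Nd by simp
      have Npos: "N u > 0" using Nd d by linarith
      have dist: "L2_set (\<lambda>x. st u x - u x) S = \<tau> * \<psi> (J u)"
        using st_dist[of u] mx Npos by simp
      have "J (st u) \<le> J u + (\<Sum>x\<in>S. G u x * (st u x - u x)) + d / 2 * L2_set (\<lambda>x. st u x - u x) S"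
        by (rule J_step[OF u(1)]) (use dist \<tau> \<psi>01 in \<open>auto simp: st_def mult_left_le\<close>)
      also have "(\<Sum>x\<in>S. G u x * (st u x - u x)) = - (\<tau> * \<psi> (J u) / N u) * (\<Sum>x\<in>S. (G u x)\<^sup>2)"
        unfolding sum_distrib_left by (intro sum.cong) (auto simp: st_def mx power2_eq_square)
      also have "(\<Sum>x\<in>S. (G u x)\<^sup>2) = N u * N u"
        using L2_set_power2[of "G u" S] by (simp add: N_def power2_eq_square)
      also have "- (\<tau> * \<psi> (J u) / N u) * (N u * N u) = - (\<tau> * \<psi> (J u)) * N u"
        using Npos by simp
      finally have *: "J (st u) \<le> J u - \<tau> * \<psi> (J u) * N u + d / 2 * (\<tau> * \<psi> (J u))"
        using dist by simp
      have "\<tau> * \<psi> (J u) * d \<le> \<tau> * \<psi> (J u) * N u"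
        using Nd \<tau> \<psi>01 by (intro mult_left_mono) auto
      with * have **: "J (st u) \<le> J u - \<tau> * \<psi> (J u) * d / 2" by (simp add: algebra_simps)
      show ?thesis
      proof (cases "J u \<ge> c - e / 2")
        case True
        then have "\<psi> (J u) = 1" by (rule \<psi>1)
        then show ?thesis using ** u(3) by auto
      next
        case False
        have "0 \<le> \<tau> * \<psi> (J u) * d" using \<tau> \<psi>01 d by simp
        then show ?thesis using ** False by linarith
      qed
    qed
    \<comment> \<open>Expand the squared norm of \<open>u - k G\<close>: the cross term has the good
      sign by \<open>outward\<close>, so the endpoint does not move inside the sphere.\<close>
    have st_out: "R \<le> L2_set (st u) S" if u: "u \<in> fball S R" "L2_set u S = R" "J u \<le> c + e" for u
    proof -
      define k where "k = \<tau> * \<psi> (J u) / max d (N u)"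
      have k: "k \<ge> 0" using \<tau> \<psi>01 d by (simp add: k_def)
      have "2 * k * (\<Sum>x\<in>S. G u x * u x) \<le> 0"
        using outward[OF u(1,2)] u(3) e(4) k by (intro mult_nonneg_nonpos) auto
      moreover have "0 \<le> k\<^sup>2 * (\<Sum>x\<in>S. (G u x)\<^sup>2)" by (simp add: sum_nonneg)
      ultimately have "R\<^sup>2 \<le> R\<^sup>2 - 2 * k * (\<Sum>x\<in>S. G u x * u x) + k\<^sup>2 * (\<Sum>x\<in>S. (G u x)\<^sup>2)"
        by linarith
      also have "\<dots> = (\<Sum>x\<in>S. (u x)\<^sup>2 - 2 * k * (G u x * u x) + k\<^sup>2 * (G u x)\<^sup>2)"
        using L2_set_power2[of u S] u(2) by (simp add: sum.distrib sum_subtractf sum_distrib_left)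
      also have "\<dots> = (\<Sum>x\<in>S. (st u x)\<^sup>2)"
        by (intro sum.cong) (auto simp: st_def k_def[symmetric] power2_eq_square algebra_simps)
      finally have "R\<^sup>2 \<le> (L2_set (st u) S)\<^sup>2" by (simp add: L2_set_power2)
      then show ?thesis by (rule power2_le_imp_le) simp
    qed
    define a where "a = c + min e (\<tau> * d / 4)"
    have "reach a"
    proof -
      have "\<exists>b\<in>{a. reach a}. b < a"
        using cInf_lessD[OF ne, of a] e(1) \<tau> d by (auto simp: a_def c_def)
      then show ?thesis using reach_mono less_imp_le by blast
    qed
    then obtain \<gamma> where "padm a \<gamma>" unfolding reach_def by blast
    then have \<gamma>: "continuous_on {0..1} \<gamma>" "\<gamma> 0 = (\<lambda>_. 0)" "L2_set (\<gamma> 1) S = R"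
      "\<forall>t\<in>{0..1::real}. \<gamma> t \<in> fball S R \<and> J (\<gamma> t) < a"
      by (simp_all add: padm_def)
    define \<beta> where "\<beta> t = st (\<gamma> t)" for t
    have \<beta>: "continuous_on {0..1} \<beta>"
      unfolding \<beta>_def by (rule continuous_on_compose2[OF st \<gamma>(1)]) auto
    have \<beta>_J: "J (\<beta> t) \<le> max (c - e / 2) (c - \<tau> * d / 4)" if "t \<in> {0..1}" for t
      unfolding \<beta>_def using \<gamma>(4)[rule_format, OF that] by (intro J_st) (auto simp: a_def)
    have \<beta>_0: "\<beta> 0 = (\<lambda>_. 0)"
      using \<psi>0[OF e(3)] by (auto simp: \<beta>_def st_def \<gamma>(2))
    have \<beta>_1: "R \<le> L2_set (\<beta> 1) S"
      unfolding \<beta>_def using \<gamma>(3) \<gamma>(4)[rule_format, of 1] by (intro st_out) (auto simp: a_def)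
    have "continuous_on {0..1} (\<lambda>t. L2_set (\<beta> t) S)"
      by (rule continuous_on_L2_set[where h = \<beta>]) (rule continuous_on_product_then_coordinatewise[OF \<beta>])
    then obtain T where T: "T \<in> {0..1}" "L2_set (\<beta> T) S = R"
      "\<And>s. s \<in> {0..T} \<Longrightarrow> L2_set (\<beta> s) S \<le> R"
      by (rule first_hit[of "\<lambda>t. L2_set (\<beta> t) S" R]) (use \<beta>_0 \<beta>_1 R in \<open>simp_all add: L2_set_def\<close>)
    \<comment> \<open>Strictly between the bound on the deformed path and \<open>c\<close>, since
      \<open>padm\<close> asks for a strict inequality.\<close>
    define b where "b = max (c - e / 4) (c - \<tau> * d / 8)"
    have "reach b"
      unfolding reach_def padm_def
    proof (intro exI[of _ "\<lambda>t. \<beta> (t * T)"] conjI ballI)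
      have in01: "t * T \<in> {0..1}" "t * T \<in> {0..T}" if "t \<in> {0..1}" for t :: real
        using that T(1) by (auto simp: mult_le_one mult_left_le_one_le)
      show "continuous_on {0..1} (\<lambda>t. \<beta> (t * T))"
        by (rule continuous_on_compose2[OF \<beta>]) (use in01 in \<open>auto intro!: continuous_intros\<close>)
      fix t :: real assume t: "t \<in> {0..1}"
      show "\<beta> (t * T) \<in> fball S R"
        using T(3)[OF in01(2)[OF t]] by (auto simp: fball_def \<beta>_def st_def)
      have "max (c - e / 2) (c - \<tau> * d / 4) < b" using e(1) \<tau> d by (auto simp: b_def max_def)
      then show "J (\<beta> (t * T)) < b" using \<beta>_J[OF in01(1)[OF t]] by linarith
    qed (use \<beta>_0 T(2) in auto)
    moreover have "b < c" using e(1) \<tau> d by (auto simp: b_def)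
    ultimately show False using not_below by blast
  qed
qed

subsection \<open>The quadratic form of a weighted graph\<close>

locale weighted_graph =
  fixes E :: "'v \<Rightarrow> 'v \<Rightarrow> bool" and w :: "'v \<Rightarrow> 'v \<Rightarrow> real" and \<mu> h :: "'v \<Rightarrow> real"
    and \<mu>min h0 :: real
  assumes graph: "locally_finite_graph E"
    and w_pos: "E x y \<Longrightarrow> w x y > 0"
    and w_sym: "E x y \<Longrightarrow> w x y = w y x"
    and \<mu>min: "\<mu>min > 0" "\<mu> x \<ge> \<mu>min"
    and h0: "h0 > 0" "h x \<ge> h0"
begin

lemma E_sym: "E x y \<longleftrightarrow> E y x"
  using graph by (auto simp: locally_finite_graph_def dest: sympD)

lemma finite_nbrs: "finite {y. E x y}"
  using graph by (auto simp: locally_finite_graph_def)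

lemma \<mu>_pos: "\<mu> x > 0" using \<mu>min(1) \<mu>min(2)[of x] by linarith

lemma h_pos: "h x > 0" using h0(1) h0(2)[of x] by linarith

definition L :: "('v \<Rightarrow> real) \<Rightarrow> 'v \<Rightarrow> real" where
  "L u x = - laplacian E w \<mu> u x + h x * u x"

text \<open>For \<open>u\<close> supported in the finite set \<open>S\<close> this is the square of
  the norm of \<H>, written as a finite sum without the gradient; see
  \<open>H_norm_eq_Q\<close>.\<close>

definition Q :: "'v set \<Rightarrow> ('v \<Rightarrow> real) \<Rightarrow> real" where
  "Q S u = (\<Sum>x\<in>S. \<mu> x * u x * L u x)"

lemma \<mu>_L: "\<mu> x * L u x = (\<Sum>y | E x y. w x y * (u x - u y)) + \<mu> x * h x * u x"
proof -
  have "(\<Sum>y | E x y. w x y * (u x - u y)) = - (\<Sum>y | E x y. w x y * (u y - u x))"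
    by (simp add: sum_negf[symmetric] algebra_simps)
  then show ?thesis
    using \<mu>_pos[of x] by (simp add: L_def laplacian_def algebra_simps)
qed

lemma L_diff: "L (\<lambda>x. u x - v x) x = L u x - L v x"
proof -
  have "\<mu> x * L (\<lambda>x. u x - v x) x = \<mu> x * L u x - \<mu> x * L v x"
    unfolding \<mu>_L by (simp add: algebra_simps sum_subtractf sum.distrib)
  then have "\<mu> x * L (\<lambda>x. u x - v x) x = \<mu> x * (L u x - L v x)" by (simp add: algebra_simps)
  then show ?thesis using \<mu>_pos[of x] by simp
qed

text \<open>If \<open>u\<close> vanishes off \<open>S\<close>, every edge along which
  \<open>u\<close> changes has both ends in this set.\<close>

definition nbhd :: "'v set \<Rightarrow> 'v set" where
  "nbhd S = S \<union> (\<Union>x\<in>S. {y. E x y})"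

lemma finite_nbhd: "finite S \<Longrightarrow> finite (nbhd S)"
  using finite_nbrs by (auto simp: nbhd_def)

text \<open>Extending the weights by 0 turns sums over edges into double sums over a finite square,
  where symmetrisation is an exchange of summation.\<close>

abbreviation edge_weight :: "'v \<Rightarrow> 'v \<Rightarrow> real" where
  "edge_weight x y \<equiv> if E x y then w x y else 0"

lemma edge_weight_sym: "edge_weight x y = edge_weight y x" using E_sym w_sym by auto

lemma sum_nbrs:
  assumes "finite T" "\<And>y. E x y \<Longrightarrow> y \<notin> T \<Longrightarrow> F y = 0"
  shows "(\<Sum>y | E x y. w x y * F y) = (\<Sum>y\<in>T. edge_weight x y * F y)"
proof -
  have "(\<Sum>y | E x y. w x y * F y) = (\<Sum>y\<in>{y. E x y} \<inter> T. w x y * F y)"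
    using assms finite_nbrs by (intro sum.mono_neutral_right) auto
  also have "\<dots> = (\<Sum>y\<in>{y. E x y} \<inter> T. edge_weight x y * F y)" by (intro sum.cong) auto
  also have "\<dots> = (\<Sum>y\<in>T. edge_weight x y * F y)"
    using assms(1) by (intro sum.mono_neutral_left) auto
  finally show ?thesis .
qed

text \<open>Summation by parts: exchange the two summation variables and add. The factor 2 arises
  because each edge is counted in both orientations. Only \<open>v\<close> has to vanish off
  \<open>S\<close>.\<close>

lemma green:
  assumes "finite S" "\<And>x. x \<notin> S \<Longrightarrow> v x = 0"
  shows "2 * (\<Sum>x\<in>S. v x * (\<Sum>y | E x y. w x y * (u x - u y))) =
    (\<Sum>x\<in>nbhd S. \<Sum>y\<in>nbhd S. edge_weight x y * (u y - u x) * (v y - v x))"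
proof -
  let ?T = "nbhd S"
  have T: "finite ?T" "S \<subseteq> ?T" using finite_nbhd[OF assms(1)] by (auto simp: nbhd_def)
  have "(\<Sum>x\<in>S. v x * (\<Sum>y | E x y. w x y * (u x - u y))) =
      (\<Sum>x\<in>S. v x * (\<Sum>y\<in>?T. edge_weight x y * (u x - u y)))"
  proof (rule sum.cong[OF refl])
    fix x assume "x \<in> S"
    then have "(\<Sum>y | E x y. w x y * (u x - u y)) = (\<Sum>y\<in>?T. edge_weight x y * (u x - u y))"
      by (intro sum_nbrs T) (auto simp: nbhd_def)
    then show "v x * (\<Sum>y | E x y. w x y * (u x - u y)) = v x * (\<Sum>y\<in>?T. edge_weight x y * (u x - u y))"
      by simp
  qed
  also have "\<dots> = (\<Sum>x\<in>?T. v x * (\<Sum>y\<in>?T. edge_weight x y * (u x - u y)))"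
    using T assms by (intro sum.mono_neutral_left) auto
  also have "\<dots> = (\<Sum>x\<in>?T. \<Sum>y\<in>?T. v x * (edge_weight x y * (u x - u y)))" (is "_ = ?X")
    by (simp add: sum_distrib_left)
  finally have X: "(\<Sum>x\<in>S. v x * (\<Sum>y | E x y. w x y * (u x - u y))) = ?X" .
  have "?X = (\<Sum>y\<in>?T. \<Sum>x\<in>?T. v x * (edge_weight x y * (u x - u y)))"
    by (rule sum.swap)
  also have "\<dots> = (\<Sum>x\<in>?T. \<Sum>y\<in>?T. v y * (edge_weight x y * (u y - u x)))"
    by (simp only: edge_weight_sym)
  finally have "2 * ?X = (\<Sum>x\<in>?T. \<Sum>y\<in>?T. v x * (edge_weight x y * (u x - u y)) + v y * (edge_weight x y * (u y - u x)))"
    by (simp only: sum.distrib mult_2)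
  also have "\<dots> = (\<Sum>x\<in>?T. \<Sum>y\<in>?T. edge_weight x y * (u y - u x) * (v y - v x))"
    by (intro sum.cong) (auto simp: algebra_simps)
  finally show ?thesis using X by simp
qed

lemma form_sym:
  assumes "finite S" "\<And>x. x \<notin> S \<Longrightarrow> u x = 0" "\<And>x. x \<notin> S \<Longrightarrow> v x = 0"
  shows "(\<Sum>x\<in>S. \<mu> x * v x * L u x) = (\<Sum>x\<in>S. \<mu> x * u x * L v x)"
proof -
  have eq: "(\<Sum>x\<in>S. \<mu> x * v x * L u x) =
      (\<Sum>x\<in>S. v x * (\<Sum>y | E x y. w x y * (u x - u y))) + (\<Sum>x\<in>S. \<mu> x * h x * u x * v x)" for u v
  proof -
    have "(\<Sum>x\<in>S. \<mu> x * v x * L u x) = (\<Sum>x\<in>S. v x * (\<mu> x * L u x))" by (simp add: ac_simps)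
    then show ?thesis unfolding \<mu>_L by (simp add: algebra_simps sum.distrib)
  qed
  have "2 * (\<Sum>x\<in>S. v x * (\<Sum>y | E x y. w x y * (u x - u y))) =
      2 * (\<Sum>x\<in>S. u x * (\<Sum>y | E x y. w x y * (v x - v y)))"
    using green[of S v u] green[of S u v] assms by (simp add: ac_simps)
  then show ?thesis unfolding eq by (simp add: ac_simps)
qed

lemma Q_eq_energy:
  assumes "finite S" "\<And>x. x \<notin> S \<Longrightarrow> u x = 0"
  shows "2 * Q S u = (\<Sum>x\<in>nbhd S. \<Sum>y\<in>nbhd S. edge_weight x y * (u y - u x)\<^sup>2) + 2 * (\<Sum>x\<in>S. \<mu> x * h x * (u x)\<^sup>2)"
proof -
  have "Q S u = (\<Sum>x\<in>S. u x * (\<mu> x * L u x))" by (simp add: Q_def ac_simps)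
  then have "Q S u = (\<Sum>x\<in>S. u x * (\<Sum>y | E x y. w x y * (u x - u y))) + (\<Sum>x\<in>S. \<mu> x * h x * (u x)\<^sup>2)"
    unfolding \<mu>_L by (simp add: algebra_simps sum.distrib power2_eq_square)
  then show ?thesis
    using green[OF assms(1), of u u, OF assms(2)] by (simp add: power2_eq_square ac_simps)
qed

lemma Q_ge:
  assumes "finite S" "\<And>x. x \<notin> S \<Longrightarrow> u x = 0"
  shows "(\<Sum>x\<in>S. \<mu> x * h x * (u x)\<^sup>2) \<le> Q S u"
proof -
  have "0 \<le> (\<Sum>x\<in>nbhd S. \<Sum>y\<in>nbhd S. edge_weight x y * (u y - u x)\<^sup>2)"
    using w_pos by (intro sum_nonneg mult_nonneg_nonneg) (auto simp: less_imp_le)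
  then show ?thesis using Q_eq_energy[of S u] assms by simp
qed

lemma Q_nonneg:
  assumes "finite S" "\<And>x. x \<notin> S \<Longrightarrow> u x = 0"
  shows "0 \<le> Q S u"
proof -
  have "0 \<le> (\<Sum>x\<in>S. \<mu> x * h x * (u x)\<^sup>2)"
    using \<mu>_pos h_pos by (intro sum_nonneg mult_nonneg_nonneg) (auto simp: less_imp_le)
  also have "\<dots> \<le> Q S u" using assms by (rule Q_ge)
  finally show ?thesis .
qed

text \<open>Translates the boundedness of \<open>g\<close> on finitely supported functions into a
  bound by \<open>Q\<close>. Off \<open>nbhd S\<close> both \<open>u\<close> and its gradient
  vanish, so the infinite sum is finite.\<close>

lemma H_norm_eq_Q:
  assumes "finite S" "\<And>x. x \<notin> S \<Longrightarrow> u x = 0"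
  shows "H_norm E w \<mu> h u = sqrt (Q S u)"
proof -
  let ?T = "nbhd S"
  have T: "finite ?T" "S \<subseteq> ?T" using finite_nbhd[OF assms(1)] by (auto simp: nbhd_def)
  let ?k = "\<lambda>x. \<mu> x * ((grad_length E w \<mu> u x)\<^sup>2 + h x * (u x)\<^sup>2)"
  have g: "2 * (\<mu> x * (grad_length E w \<mu> u x)\<^sup>2) = (\<Sum>y | E x y. w x y * (u y - u x)\<^sup>2)" for x
  proof -
    have "0 \<le> (\<Sum>y | E x y. w x y * (u y - u x)\<^sup>2)"
      using w_pos by (intro sum_nonneg mult_nonneg_nonneg) (auto simp: less_imp_le)
    then show ?thesis using \<mu>_pos[of x] by (simp add: grad_length_def)
  qed
  have off: "?k x = 0" if "x \<notin> ?T" for x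
  proof -
    have "u y = 0" if "E x y" for y
      using that \<open>x \<notin> ?T\<close> assms(2) E_sym by (auto simp: nbhd_def)
    moreover have "u x = 0" using \<open>x \<notin> ?T\<close> assms(2) T by auto
    ultimately have "(\<Sum>y | E x y. w x y * (u y - u x)\<^sup>2) = 0" by (intro sum.neutral) auto
    then show ?thesis using g[of x] \<open>u x = 0\<close> by simp
  qed
  have "vint \<mu> (\<lambda>x. (grad_length E w \<mu> u x)\<^sup>2 + h x * (u x)\<^sup>2) = infsum ?k ?T"
    unfolding vint_def using off by (intro infsum_cong_neutral) auto
  also have "\<dots> = sum ?k ?T" using T by simp
  finally have "2 * vint \<mu> (\<lambda>x. (grad_length E w \<mu> u x)\<^sup>2 + h x * (u x)\<^sup>2) =
      (\<Sum>x\<in>?T. 2 * (\<mu> x * (grad_length E w \<mu> u x)\<^sup>2)) + 2 * (\<Sum>x\<in>?T. \<mu> x * h x * (u x)\<^sup>2)"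
    by (simp add: sum.distrib algebra_simps sum_distrib_left)
  also have "(\<Sum>x\<in>?T. 2 * (\<mu> x * (grad_length E w \<mu> u x)\<^sup>2)) =
      (\<Sum>x\<in>?T. \<Sum>y\<in>?T. edge_weight x y * (u y - u x)\<^sup>2)"
  proof (rule sum.cong[OF refl])
    fix x assume "x \<in> ?T"
    have "u y = u x" if "E x y" "y \<notin> ?T" for y
      using that assms(2) T by (cases "x \<in> S") (auto simp: nbhd_def)
    then show "2 * (\<mu> x * (grad_length E w \<mu> u x)\<^sup>2) = (\<Sum>y\<in>?T. edge_weight x y * (u y - u x)\<^sup>2)"
      unfolding g by (intro sum_nbrs T) auto
  qed
  also have "(\<Sum>x\<in>?T. \<mu> x * h x * (u x)\<^sup>2) = (\<Sum>x\<in>S. \<mu> x * h x * (u x)\<^sup>2)"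
    using T assms by (intro sum.mono_neutral_right) auto
  finally show ?thesis
    using Q_eq_energy[of S u] assms by (simp add: H_norm_def)
qed

text \<open>The embedding into bounded functions: a single vertex already carries mass at least
  \<open>\<mu>min * h0\<close>, whatever \<open>S\<close> is.\<close>

lemma le_Q_pointwise:
  assumes "finite S" "\<And>x. x \<notin> S \<Longrightarrow> u x = 0"
  shows "\<mu>min * h0 * (u x)\<^sup>2 \<le> Q S u"
proof (cases "x \<in> S")
  case True
  have "\<mu>min * h0 * (u x)\<^sup>2 \<le> \<mu> x * h x * (u x)\<^sup>2"
    using \<mu>min(1) \<mu>min(2)[of x] h0(1) h0(2)[of x] by (intro mult_mono) auto
  also have "\<dots> \<le> (\<Sum>x\<in>S. \<mu> x * h x * (u x)\<^sup>2)"
    using True assms(1) \<mu>_pos h_pos by (intro member_le_sum) (auto simp: less_imp_le)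
  also have "\<dots> \<le> Q S u" using assms by (rule Q_ge)
  finally show ?thesis .
qed (use Q_nonneg[OF assms] assms(2) in auto)

lemma L2_le_Q:
  assumes "finite S" "\<And>x. x \<notin> S \<Longrightarrow> u x = 0"
  shows "\<mu>min * h0 * (L2_set u S)\<^sup>2 \<le> Q S u"
proof -
  have "\<mu>min * h0 * (L2_set u S)\<^sup>2 = (\<Sum>x\<in>S. \<mu>min * h0 * (u x)\<^sup>2)"
    by (simp add: L2_set_power2 sum_distrib_left)
  also have "\<dots> \<le> (\<Sum>x\<in>S. \<mu> x * h x * (u x)\<^sup>2)"
    using \<mu>min h0 \<mu>_pos h_pos by (intro sum_mono mult_mono) (auto intro!: mult_nonneg_nonneg less_imp_le)
  also have "\<dots> \<le> Q S u" using assms by (rule Q_ge)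
  finally show ?thesis .
qed

text \<open>On a fixed finite set all norms are equivalent. The constant depends on
  \<open>S\<close>, which is harmless because it only sets step lengths on that set.\<close>

lemma Q_le_L2:
  assumes "finite S"
  obtains \<Lambda> where "\<Lambda> > 0"
    "\<And>u. (\<And>x. x \<notin> S \<Longrightarrow> u x = 0) \<Longrightarrow> Q S u \<le> \<Lambda> * (L2_set u S)\<^sup>2"
proof -
  \<comment> \<open>The factor 2 comes from bounding \<open>u x - u y\<close> by twice the norm; the
    added 1 keeps the constant positive for empty \<open>S\<close> too.\<close>
  define \<Lambda> where "\<Lambda> = 1 + (\<Sum>x\<in>S. (\<Sum>y | E x y. w x y * 2) + \<mu> x * h x)"
  have "0 \<le> (\<Sum>x\<in>S. (\<Sum>y | E x y. w x y * 2) + \<mu> x * h x)"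
    using w_pos \<mu>_pos h_pos by (intro sum_nonneg add_nonneg_nonneg mult_nonneg_nonneg) (auto simp: less_imp_le)
  then have pos: "\<Lambda> > 0" by (simp add: \<Lambda>_def)
  moreover have "Q S u \<le> \<Lambda> * (L2_set u S)\<^sup>2" if u: "\<And>x. x \<notin> S \<Longrightarrow> u x = 0" for u
  proof -
    define n where "n = L2_set u S"
    have n: "\<bar>u x\<bar> \<le> n" for x
      using abs_le_L2_set[OF assms, of x u] u[of x] by (cases "x \<in> S") (auto simp: n_def)
    have "Q S u = (\<Sum>x\<in>S. u x * (\<mu> x * L u x))" by (simp add: Q_def ac_simps)
    also have "\<dots> \<le> (\<Sum>x\<in>S. n * (((\<Sum>y | E x y. w x y * 2) + \<mu> x * h x) * n))"
    proof (rule sum_mono)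
      fix x
      have "\<bar>\<mu> x * L u x\<bar> \<le> (\<Sum>y | E x y. \<bar>w x y * (u x - u y)\<bar>) + \<bar>\<mu> x * h x * u x\<bar>"
        unfolding \<mu>_L using sum_abs[of "\<lambda>y. w x y * (u x - u y)" "{y. E x y}"] by linarith
      also have "\<dots> \<le> (\<Sum>y | E x y. w x y * (2 * n)) + \<mu> x * h x * n"
      proof (intro add_mono sum_mono)
        fix y assume "y \<in> {y. E x y}"
        then have "w x y > 0" using w_pos by simp
        moreover have "\<bar>u x - u y\<bar> \<le> 2 * n" using n[of x] n[of y] by linarith
        ultimately show "\<bar>w x y * (u x - u y)\<bar> \<le> w x y * (2 * n)"
          by (simp add: abs_mult)
      qed (use n \<mu>_pos[of x] h_pos[of x] in \<open>simp add: abs_mult\<close>)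
      also have "\<dots> = ((\<Sum>y | E x y. w x y * 2) + \<mu> x * h x) * n"
        by (simp add: algebra_simps sum_distrib_left sum_distrib_right)
      finally have "\<bar>\<mu> x * L u x\<bar> \<le> ((\<Sum>y | E x y. w x y * 2) + \<mu> x * h x) * n" .
      then have "\<bar>u x * (\<mu> x * L u x)\<bar> \<le> n * (((\<Sum>y | E x y. w x y * 2) + \<mu> x * h x) * n)"
        unfolding abs_mult[of "u x"] using n[of x] by (intro mult_mono) auto
      then show "u x * (\<mu> x * L u x) \<le> n * (((\<Sum>y | E x y. w x y * 2) + \<mu> x * h x) * n)"
        by linarith
    qed
    also have "\<dots> = (\<Lambda> - 1) * n\<^sup>2"
      by (simp add: \<Lambda>_def sum_distrib_left sum_distrib_right power2_eq_square ac_simps)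
    also have "\<dots> \<le> \<Lambda> * n\<^sup>2" by (simp add: mult_right_mono)
    finally show ?thesis by (simp add: n_def)
  qed
  ultimately show ?thesis by (rule that)
qed

lemma continuous_on_L: "continuous_on UNIV (\<lambda>u. L u x)"
  unfolding L_def laplacian_def
  by (intro continuous_intros continuous_on_product_coordinates)

lemma continuous_on_Q: "continuous_on UNIV (Q S)"
proof -
  have "continuous_on UNIV (\<lambda>u. Q S u)"
    unfolding Q_def by (intro continuous_on_sum continuous_on_mult continuous_on_const
        continuous_on_product_coordinates continuous_on_L)
  then show ?thesis .
qed

lemma L_cong:
  assumes "u x = v x" "\<And>y. E x y \<Longrightarrow> u y = v y"
  shows "L u x = L v x"
proof -
  have "(\<Sum>y | E x y. w x y * (u y - u x)) = (\<Sum>y | E x y. w x y * (v y - v x))"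
    using assms by (intro sum.cong) auto
  then show ?thesis using assms(1) by (simp add: L_def laplacian_def)
qed

section \<open>Connected components\<close>

definition component :: "'v \<Rightarrow> 'v set" where
  "component x = {y. E\<^sup>*\<^sup>* x y}"

lemma component_refl: "x \<in> component x"
  by (simp add: component_def)

lemma component_step: "y \<in> component x \<Longrightarrow> E y z \<Longrightarrow> z \<in> component x"
  by (simp add: component_def)

lemma component_sym: "y \<in> component x \<Longrightarrow> x \<in> component y"
  unfolding component_def mem_Collect_eq
  by (metis E_sym sympD sympI symp_rtranclp)

lemma component_eq: "y \<in> component x \<Longrightarrow> component y = component x"
  using component_sym[of y x] by (auto simp: component_def)

end

subsection \<open>The energy functional on finite vertex sets\<close>

lemma finite_uniform_threshold:
  fixes P :: "'a \<Rightarrow> real \<Rightarrow> bool"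
  assumes "finite S" "\<And>x. x \<in> S \<Longrightarrow> \<exists>\<tau>>0. P x \<tau>" "\<And>x s t. P x t \<Longrightarrow> s \<le> t \<Longrightarrow> P x s"
  shows "\<exists>\<tau>>0. \<forall>x\<in>S. P x \<tau>"
  using assms(1,2)
proof (induction S rule: finite_induct)
  case empty
  show ?case by (intro exI[of _ 1]) auto
next
  case (insert x S)
  obtain \<tau>1 where "\<tau>1 > 0" "P x \<tau>1" using insert.prems[of x] by auto
  moreover obtain \<tau>2 where "\<tau>2 > 0" "\<forall>y\<in>S. P y \<tau>2" using insert by auto
  ultimately show ?case by (intro exI[of _ "min \<tau>1 \<tau>2"]) (auto intro: assms(3))
qed

text \<open>Mean value theorem and uniform continuity of \<open>f\<close> on a slightly larger
  interval. A lower bound suffices because \<open>F\<close> enters the energy with a minus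
  sign.\<close>

lemma C1_uniform_lower_expansion:
  fixes f F :: "real \<Rightarrow> real"
  assumes f: "continuous_on UNIV f" and F: "\<And>s. (F has_real_derivative f s) (at s)" and \<eta>: "\<eta> > 0"
  shows "\<exists>\<tau>>0. \<forall>s t. \<bar>s\<bar> \<le> R \<longrightarrow> \<bar>t - s\<bar> \<le> \<tau> \<longrightarrow> F s + f s * (t - s) - \<eta> * \<bar>t - s\<bar> \<le> F t"
proof -
  have "uniformly_continuous_on {-R-1..R+1} f"
    using f by (intro compact_uniformly_continuous) (auto intro: continuous_on_subset)
  then obtain d where d: "d > 0"
    "\<And>s t. s \<in> {-R-1..R+1} \<Longrightarrow> t \<in> {-R-1..R+1} \<Longrightarrow> dist t s < d \<Longrightarrow> dist (f t) (f s) < \<eta>"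
    using \<eta> unfolding uniformly_continuous_on_def by metis
  define \<tau> where "\<tau> = min 1 (d / 2)"
  have "F s + f s * (t - s) - \<eta> * \<bar>t - s\<bar> \<le> F t" if s: "\<bar>s\<bar> \<le> R" and t: "\<bar>t - s\<bar> \<le> \<tau>" for s t
  proof -
    have near: "\<bar>f z - f s\<bar> \<le> \<eta>" if "\<bar>z - s\<bar> \<le> \<bar>t - s\<bar>" for z
    proof -
      have "\<bar>t - s\<bar> \<le> 1" "\<bar>t - s\<bar> < d" using t \<open>d > 0\<close> by (auto simp: \<tau>_def)
      then have "s \<in> {-R-1..R+1}" "z \<in> {-R-1..R+1}" "dist z s < d"
        using s that by (auto simp: dist_real_def)
      then show ?thesis using d(2)[of s z] by (simp add: dist_real_def)
    qed
    obtain z where z: "\<bar>z - s\<bar> \<le> \<bar>t - s\<bar>" "F t - F s = (t - s) * f z"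
    proof (cases s t rule: linorder_cases)
      case less
      then show ?thesis using MVT2[of s t F f] F by (force intro: that)
    next
      case greater
      then obtain z where "t < z" "z < s" "F s - F t = (s - t) * f z"
        using MVT2[of t s F f] F by force
      then show ?thesis by (intro that[of z]) (auto simp: algebra_simps)
    qed (use that in auto)
    have "- (\<eta> * \<bar>t - s\<bar>) \<le> (f z - f s) * (t - s)"
    proof -
      have "\<bar>(f z - f s) * (t - s)\<bar> \<le> \<eta> * \<bar>t - s\<bar>"
        unfolding abs_mult using near[OF z(1)] by (intro mult_right_mono) auto
      then show ?thesis by linarith
    qed
    with z(2) show ?thesis by (simp add: algebra_simps)
  qed
  moreover have "\<tau> > 0" using d(1) by (simp add: \<tau>_def)
  ultimately show ?thesis by blast
qed

text \<open>Here \<open>f\<close> is the nonlinearity already cut off to 0 at negative arguments,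
  which makes critical points nonnegative; \<open>g_bound\<close> expresses that \<open>g\<close>
  lies in the dual space.\<close>

locale superlinear_problem = weighted_graph E w \<mu> h \<mu>min h0
  for E :: "'v \<Rightarrow> 'v \<Rightarrow> bool" and w :: "'v \<Rightarrow> 'v \<Rightarrow> real" and \<mu> h :: "'v \<Rightarrow> real"
    and \<mu>min h0 :: real +
  fixes f F :: "'v \<Rightarrow> real \<Rightarrow> real" and g :: "'v \<Rightarrow> real" and \<theta> Cg :: real
  assumes f_cont: "continuous_on UNIV (f x)"
    and F_deriv: "(F x has_real_derivative f x s) (at s)"
    and f_neg: "s \<le> 0 \<Longrightarrow> f x s = 0"
    and F_neg: "s \<le> 0 \<Longrightarrow> F x s = 0"
    and f_bound: "M > 0 \<Longrightarrow> \<exists>A. \<forall>x. \<forall>s\<in>{0..M}. f x s \<le> A"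
    and \<theta>: "\<theta> > 2"
    and F_pos: "s > 0 \<Longrightarrow> 0 < F x s"
    and AR: "s > 0 \<Longrightarrow> \<theta> * F x s \<le> s * f x s"
    and h_inv: "(\<lambda>x. \<mu> x / h x) summable_on UNIV"
    and g_nonneg: "g x \<ge> 0"
    and Cg: "Cg > 0"
    and g_bound: "finite S \<Longrightarrow> (\<And>x. x \<notin> S \<Longrightarrow> u x = 0) \<Longrightarrow>
      (\<Sum>x\<in>S. \<mu> x * g x * u x) \<le> Cg * sqrt (Q S u)"
begin

section \<open>Growth of the primitive and a uniform radius\<close>

lemma F_nonneg: "F x s \<ge> 0"
  using F_pos[of s x] F_neg[of s x] by (cases "s > 0") auto

lemma AR': "\<theta> * F x s \<le> s * f x s"
  using AR[of s x] F_neg[of s x] f_neg[of s x] by (cases "s > 0") auto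

lemma F_cont: "continuous_on UNIV (F x)"
  using F_deriv by (meson DERIV_isCont continuous_at_imp_continuous_on)

text \<open>The derivative of \<open>F x z * z powr (-\<theta>)\<close> is nonnegative by
  \<open>AR'\<close>. The product form gives an upper bound on \<open>F\<close> below 1 and
  superquadratic growth above 1.\<close>

lemma F_powr_mono:
  assumes "0 < s" "s \<le> t"
  shows "F x s * t powr \<theta> \<le> F x t * s powr \<theta>"
proof -
  have "F x s * s powr (-\<theta>) \<le> F x t * t powr (-\<theta>)"
  proof (rule DERIV_nonneg_imp_nondecreasing[OF assms(2)])
    fix z assume "s \<le> z" "z \<le> t"
    with assms have z: "z > 0" by linarith
    have "((\<lambda>z. F x z * z powr (-\<theta>)) has_real_derivative
        f x z * z powr (-\<theta>) + F x z * (-\<theta> * z powr (-\<theta> - 1))) (at z)"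
      using z by (auto intro!: derivative_eq_intros F_deriv)
    moreover have "f x z * z powr (-\<theta>) + F x z * (-\<theta> * z powr (-\<theta> - 1)) =
        (z * f x z - \<theta> * F x z) * z powr (-\<theta> - 1)"
    proof -
      have "z powr (-\<theta>) = z * z powr (-\<theta> - 1)"
        using z powr_add[of z 1 "-\<theta> - 1"] by simp
      then show ?thesis by (simp add: algebra_simps)
    qed
    moreover have "0 \<le> (z * f x z - \<theta> * F x z) * z powr (-\<theta> - 1)"
      using AR'[of x z] by simp
    ultimately show "\<exists>y. ((\<lambda>z. F x z * z powr (-\<theta>)) has_real_derivative y) (at z) \<and> 0 \<le> y" by metis
  qed
  then show ?thesis using assms by (simp add: powr_minus field_simps)
qed

lemma powr_split: "z > 0 \<Longrightarrow> z powr \<theta> = z\<^sup>2 * z powr (\<theta> - 2)" for z :: real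
  using powr_add[of z 2 "\<theta> - 2"] by (simp add: powr_numeral)

text \<open>Quantifying over all \<open>S\<close> makes one radius serve the whole exhaustion. The
  factor 1/4 leaves half of the quadratic term of the energy.\<close>

definition small_radius :: "real \<Rightarrow> bool" where
  "small_radius r \<longleftrightarrow> r > 0 \<and> (\<forall>S u. finite S \<longrightarrow> (\<forall>x. x \<notin> S \<longrightarrow> u x = 0) \<longrightarrow> Q S u \<le> r\<^sup>2 \<longrightarrow>
    (\<Sum>x\<in>S. \<mu> x * F x (u x)) \<le> Q S u / 4)"

lemma small_radius_pos: "small_radius r \<Longrightarrow> r > 0"
  by (simp add: small_radius_def)

lemma small_radiusD:
  "small_radius r \<Longrightarrow> finite S \<Longrightarrow> (\<And>x. x \<notin> S \<Longrightarrow> u x = 0) \<Longrightarrow> Q S u \<le> r\<^sup>2 \<Longrightarrow>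
    (\<Sum>x\<in>S. \<mu> x * F x (u x)) \<le> Q S u / 4"
  by (simp only: small_radius_def) blast

text \<open>For arguments at most 1 the primitive is bounded by \<open>A * s powr \<theta>\<close>
  with \<open>A\<close> independent of the vertex, hence by \<open>h x * s\<^sup>2 / 4\<close> near
  0; a small \<open>Q S u\<close> forces all values of \<open>u\<close> to be that small.\<close>

lemma small_radius_exists:
  obtains r where "small_radius r"
proof -
  obtain A0 where "\<forall>x. \<forall>s\<in>{0..1}. f x s \<le> A0" using f_bound[of 1] by auto
  then have A0: "f x 1 \<le> A0" for x by simp
  define A where "A = max A0 1"
  have A: "A > 0" "F x 1 \<le> A" for x
  proof -
    have "F x 1 * 1 \<le> F x 1 * \<theta>" using F_nonneg[of x 1] \<theta> by (intro mult_left_mono) auto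
    then show "F x 1 \<le> A" using AR'[of x 1] A0[of x] by (simp add: A_def ac_simps)
  qed (simp add: A_def)
  \<comment> \<open>Solves \<open>A * \<rho> powr (\<theta> - 2) = h0 / 4\<close>, capped at 1 to
    stay where the bound on \<open>F\<close> holds.\<close>
  define \<rho> where "\<rho> = min 1 ((h0 / (4 * A)) powr (1 / (\<theta> - 2)))"
  have \<rho>: "0 < \<rho>" "\<rho> \<le> 1" "A * \<rho> powr (\<theta> - 2) \<le> h0 / 4"
  proof -
    show "0 < \<rho>" "\<rho> \<le> 1" using A h0 by (auto simp: \<rho>_def)
    have "\<rho> powr (\<theta> - 2) \<le> ((h0 / (4 * A)) powr (1 / (\<theta> - 2))) powr (\<theta> - 2)"
      using \<open>0 < \<rho>\<close> \<theta> by (intro powr_mono2) (auto simp: \<rho>_def)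
    also have "\<dots> = h0 / (4 * A)" using \<theta> h0 A by (simp add: powr_powr)
    finally show "A * \<rho> powr (\<theta> - 2) \<le> h0 / 4" using A by (simp add: field_simps)
  qed
  have F_le: "F x s \<le> h x * s\<^sup>2 / 4" if "\<bar>s\<bar> \<le> \<rho>" for x s
  proof (cases "s > 0")
    case True
    have "F x s \<le> F x 1 * s powr \<theta>" using F_powr_mono[of s 1 x] True that \<rho> by auto
    also have "\<dots> \<le> A * s powr \<theta>" using A by (intro mult_right_mono) auto
    also have "\<dots> = s\<^sup>2 * (A * s powr (\<theta> - 2))" using powr_split[OF True] by simp
    also have "\<dots> \<le> s\<^sup>2 * (A * \<rho> powr (\<theta> - 2))"
      using True that A \<theta> by (intro mult_left_mono powr_mono2) auto
    also have "\<dots> \<le> s\<^sup>2 * (h x / 4)" using \<rho>(3) h0(2)[of x] by (intro mult_left_mono) auto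
    finally show ?thesis by (simp add: ac_simps)
  next
    case False
    then show ?thesis using F_neg[of s x] h_pos[of x] by simp
  qed
  have "small_radius (sqrt (\<mu>min * h0) * \<rho>)"
    unfolding small_radius_def
  proof (intro conjI allI impI)
    show "sqrt (\<mu>min * h0) * \<rho> > 0" using \<mu>min h0 \<rho> by simp
    fix S and u :: "'v \<Rightarrow> real"
    assume S: "finite S" "\<forall>x. x \<notin> S \<longrightarrow> u x = 0" and le: "Q S u \<le> (sqrt (\<mu>min * h0) * \<rho>)\<^sup>2"
    have "\<bar>u x\<bar> \<le> \<rho>" for x
    proof -
      have "\<mu>min * h0 * (u x)\<^sup>2 \<le> \<mu>min * h0 * \<rho>\<^sup>2"
        using order_trans[OF le_Q_pointwise[of S u x] le] S \<mu>min(1) h0(1)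
        by (simp add: power_mult_distrib)
      then have "(u x)\<^sup>2 \<le> \<rho>\<^sup>2" using \<mu>min(1) h0(1) by simp
      then show ?thesis using \<rho>(1) by (metis abs_le_square_iff abs_of_pos)
    qed
    then have "(\<Sum>x\<in>S. \<mu> x * F x (u x)) \<le> (\<Sum>x\<in>S. \<mu> x * (h x * (u x)\<^sup>2 / 4))"
      using F_le \<mu>_pos by (intro sum_mono mult_left_mono) (auto simp: less_imp_le)
    also have "\<dots> = (\<Sum>x\<in>S. \<mu> x * h x * (u x)\<^sup>2) / 4" by (simp add: sum_divide_distrib ac_simps)
    also have "\<dots> \<le> Q S u / 4" using Q_ge[of S u] S by simp
    finally show "(\<Sum>x\<in>S. \<mu> x * F x (u x)) \<le> Q S u / 4" .
  qed
  then show ?thesis by (rule that)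
qed

section \<open>The energy and its first-order expansion\<close>

definition J :: "'v set \<Rightarrow> real \<Rightarrow> ('v \<Rightarrow> real) \<Rightarrow> real" where
  "J S \<epsilon> u = Q S u / 2 - (\<Sum>x\<in>S. \<mu> x * F x (u x)) - \<epsilon> * (\<Sum>x\<in>S. \<mu> x * g x * u x)"

text \<open>The partial derivative of \<open>J S \<epsilon>\<close> at the coordinate
  \<open>x\<close> in \<open>S\<close>, for functions supported in \<open>S\<close>; its vanishing
  is the equation at \<open>x\<close>.\<close>

definition DJ :: "real \<Rightarrow> ('v \<Rightarrow> real) \<Rightarrow> 'v \<Rightarrow> real" where
  "DJ \<epsilon> u x = \<mu> x * (L u x - f x (u x) - \<epsilon> * g x)"

text \<open>The density left of the energy after subtracting half the derivative in direction
  \<open>u\<close>, up to the term with \<open>g\<close>. It is what tells the two solutions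
  apart.\<close>

definition \<Phi> :: "'v \<Rightarrow> real \<Rightarrow> real" where
  "\<Phi> x s = \<mu> x * (s * f x s / 2 - F x s)"

lemma J_0: "J S \<epsilon> (\<lambda>_. 0) = 0"
  using F_neg[of 0] by (simp add: J_def Q_def)

lemma continuous_on_J: "continuous_on UNIV (J S \<epsilon>)"
proof -
  have "continuous_on UNIV (\<lambda>u. F x (u x))" for x
    by (rule continuous_on_compose2[OF F_cont continuous_on_product_coordinates]) auto
  then have "continuous_on UNIV (\<lambda>u. J S \<epsilon> u)"
    unfolding J_def by (intro continuous_on_diff continuous_on_sum continuous_on_mult continuous_on_const
        continuous_on_product_coordinates continuous_on_divide continuous_on_Q) auto
  then show ?thesis .
qed

lemma continuous_on_DJ: "continuous_on UNIV (\<lambda>u. DJ \<epsilon> u x)"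
proof -
  have "continuous_on UNIV (\<lambda>u. f x (u x))"
    by (rule continuous_on_compose2[OF f_cont continuous_on_product_coordinates]) auto
  then show ?thesis
    unfolding DJ_def by (intro continuous_on_diff continuous_on_mult continuous_on_const continuous_on_L)
qed

lemma Q_expand:
  assumes "finite S" "\<And>x. x \<notin> S \<Longrightarrow> u x = 0" "\<And>x. x \<notin> S \<Longrightarrow> v x = 0"
  shows "Q S v = Q S u + 2 * (\<Sum>x\<in>S. \<mu> x * L u x * (v x - u x)) + Q S (\<lambda>x. v x - u x)"
proof -
  let ?B = "\<lambda>u v. \<Sum>x\<in>S. \<mu> x * v x * L u x"
  have "Q S (\<lambda>x. v x - u x) = ?B v v - ?B v u - ?B u v + ?B u u"
    unfolding Q_def L_diff by (simp add: algebra_simps sum.distrib sum_subtractf)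
  moreover have "?B v u = ?B u v" by (rule form_sym) (use assms in auto)
  moreover have "(\<Sum>x\<in>S. \<mu> x * L u x * (v x - u x)) = ?B u v - ?B u u"
    by (simp add: algebra_simps sum_subtractf)
  ultimately show ?thesis by (simp add: Q_def)
qed

lemma J_expand:
  assumes "finite S" "\<And>x. x \<notin> S \<Longrightarrow> u x = 0" "\<And>x. x \<notin> S \<Longrightarrow> v x = 0"
  shows "J S \<epsilon> v = J S \<epsilon> u + (\<Sum>x\<in>S. DJ \<epsilon> u x * (v x - u x)) + Q S (\<lambda>x. v x - u x) / 2
    - (\<Sum>x\<in>S. \<mu> x * (F x (v x) - F x (u x) - f x (u x) * (v x - u x)))"
proof -
  have "Q S v / 2 = Q S u / 2 + (\<Sum>x\<in>S. \<mu> x * L u x * (v x - u x)) + Q S (\<lambda>x. v x - u x) / 2"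
    using Q_expand[of S u v] assms by simp
  moreover have "(\<Sum>x\<in>S. DJ \<epsilon> u x * (v x - u x)) = (\<Sum>x\<in>S. \<mu> x * L u x * (v x - u x)) -
      (\<Sum>x\<in>S. \<mu> x * (f x (u x) * (v x - u x))) - \<epsilon> * (\<Sum>x\<in>S. \<mu> x * g x * v x) +
      \<epsilon> * (\<Sum>x\<in>S. \<mu> x * g x * u x)"
    unfolding DJ_def by (simp add: algebra_simps sum.distrib sum_subtractf sum_distrib_left)
  moreover have "(\<Sum>x\<in>S. \<mu> x * (F x (v x) - F x (u x) - f x (u x) * (v x - u x))) =
      (\<Sum>x\<in>S. \<mu> x * F x (v x)) - (\<Sum>x\<in>S. \<mu> x * F x (u x)) - (\<Sum>x\<in>S. \<mu> x * (f x (u x) * (v x - u x)))"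
    by (simp only: right_diff_distrib sum_subtractf)
  ultimately show ?thesis unfolding J_def by linarith
qed

text \<open>Supplies the hypothesis \<open>diff\<close> of the mountain pass theorem. In
  \<open>J_expand\<close> the quadratic remainder and the remainder of \<open>F\<close> each take
  half of \<eta>.\<close>

lemma J_step:
  assumes S: "finite S" and \<eta>: "\<eta> > 0"
  shows "\<exists>\<tau>>0. \<forall>u\<in>fball S R. \<forall>v. (\<forall>x. x \<notin> S \<longrightarrow> v x = 0) \<longrightarrow> L2_set (\<lambda>x. v x - u x) S \<le> \<tau> \<longrightarrow>
    J S \<epsilon> v \<le> J S \<epsilon> u + (\<Sum>x\<in>S. DJ \<epsilon> u x * (v x - u x)) + \<eta> * L2_set (\<lambda>x. v x - u x) S"
proof -
  obtain \<Lambda> where \<Lambda>: "\<Lambda> > 0"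
    "\<And>u. (\<And>x. x \<notin> S \<Longrightarrow> u x = 0) \<Longrightarrow> Q S u \<le> \<Lambda> * (L2_set u S)\<^sup>2"
    using Q_le_L2[OF S] by blast
  define m where "m = 1 + (\<Sum>x\<in>S. \<mu> x)"
  have "0 \<le> (\<Sum>x\<in>S. \<mu> x)" using \<mu>_pos by (intro sum_nonneg) (auto simp: less_imp_le)
  then have m: "m > 0" by (simp add: m_def)
  \<comment> \<open>Chosen so that the errors of \<open>F\<close>, weighted by \<open>\<mu>\<close>
    and summed over \<open>S\<close>, stay within half of \<eta> times the distance.\<close>
  define k where "k = \<eta> / (2 * m)"
  have k: "k > 0" using \<eta> m by (simp add: k_def)
  have "\<exists>\<tau>>0. \<forall>x\<in>S. \<forall>s t. \<bar>s\<bar> \<le> R \<longrightarrow> \<bar>t - s\<bar> \<le> \<tau> \<longrightarrow>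
      F x s + f x s * (t - s) - k * \<bar>t - s\<bar> \<le> F x t"
  proof (rule finite_uniform_threshold[OF S])
    show "\<exists>\<tau>>0. \<forall>s t. \<bar>s\<bar> \<le> R \<longrightarrow> \<bar>t - s\<bar> \<le> \<tau> \<longrightarrow>
        F x s + f x s * (t - s) - k * \<bar>t - s\<bar> \<le> F x t" for x
      by (rule C1_uniform_lower_expansion[OF f_cont F_deriv k])
  qed force
  then obtain \<tau>1 where \<tau>1: "\<tau>1 > 0" "\<forall>x\<in>S. \<forall>s t. \<bar>s\<bar> \<le> R \<longrightarrow> \<bar>t - s\<bar> \<le> \<tau>1 \<longrightarrow>
      F x s + f x s * (t - s) - k * \<bar>t - s\<bar> \<le> F x t" by blast
  define \<tau> where "\<tau> = min \<tau>1 (\<eta> / \<Lambda>)"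
  have \<tau>: "\<tau> > 0" using \<tau>1 \<eta> \<Lambda> by (simp add: \<tau>_def)
  show ?thesis
  proof (intro exI[of _ \<tau>] conjI ballI allI impI)
    fix u v assume u: "u \<in> fball S R" and v: "\<forall>x. x \<notin> S \<longrightarrow> v x = 0"
      and d: "L2_set (\<lambda>x. v x - u x) S \<le> \<tau>"
    define n where "n = L2_set (\<lambda>x. v x - u x) S"
    have n0: "0 \<le> n" by (simp add: n_def)
    have u0: "\<And>x. x \<notin> S \<Longrightarrow> u x = 0" using u by (simp add: fball_def)
    have "Q S (\<lambda>x. v x - u x) \<le> \<Lambda> * n\<^sup>2" unfolding n_def by (rule \<Lambda>(2)) (use v u0 in auto)
    also have "\<dots> = (\<Lambda> * n) * n" by (simp add: power2_eq_square)
    also have "\<dots> \<le> \<eta> * n"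
      using d \<Lambda>(1) n0 by (intro mult_right_mono) (auto simp: \<tau>_def n_def[symmetric] field_simps)
    finally have Qd: "Q S (\<lambda>x. v x - u x) \<le> \<eta> * n" .
    have "(\<Sum>x\<in>S. \<mu> x * (- (k * n))) \<le> (\<Sum>x\<in>S. \<mu> x * (F x (v x) - F x (u x) - f x (u x) * (v x - u x)))"
    proof (intro sum_mono mult_left_mono)
      fix x assume x: "x \<in> S"
      have "\<bar>u x\<bar> \<le> R" using abs_le_L2_set[OF S x, of u] u by (simp add: fball_def)
      moreover have n: "\<bar>v x - u x\<bar> \<le> n" unfolding n_def by (rule abs_le_L2_set[OF S x])
      moreover have "n \<le> \<tau>1" using d by (simp add: n_def \<tau>_def)
      ultimately have "F x (u x) + f x (u x) * (v x - u x) - k * \<bar>v x - u x\<bar> \<le> F x (v x)"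
        using \<tau>1(2) x by simp
      moreover have "k * \<bar>v x - u x\<bar> \<le> k * n" using n k by simp
      ultimately show "- (k * n) \<le> F x (v x) - F x (u x) - f x (u x) * (v x - u x)" by linarith
    qed (use \<mu>_pos in \<open>auto simp: less_imp_le\<close>)
    moreover have "(\<Sum>x\<in>S. \<mu> x * (- (k * n))) = - ((m - 1) * (k * n))"
      by (simp add: m_def sum_distrib_right sum_negf)
    moreover have "(m - 1) * (k * n) \<le> m * (k * n)" using k n0 by (intro mult_right_mono) auto
    moreover have "m * (k * n) = \<eta> * n / 2" using m by (simp add: k_def)
    ultimately have "- (\<eta> * n / 2) \<le> (\<Sum>x\<in>S. \<mu> x * (F x (v x) - F x (u x) - f x (u x) * (v x - u x)))"
      by linarith
    with J_expand[of S u v \<epsilon>] S u0 v Qd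
    show "J S \<epsilon> v \<le> J S \<epsilon> u + (\<Sum>x\<in>S. DJ \<epsilon> u x * (v x - u x)) + \<eta> * L2_set (\<lambda>x. v x - u x) S"
      unfolding n_def[symmetric] by simp
  qed (rule \<tau>)
qed

text \<open>In \<open>\<theta> * J\<close> minus the derivative in direction \<open>u\<close> the
  superlinear terms combine to a nonnegative sum, leaving a positive multiple of \<open>Q\<close>
  and the linear term.\<close>

lemma AR_energy:
  assumes "finite S" "\<And>x. x \<notin> S \<Longrightarrow> u x = 0" "\<epsilon> \<ge> 0"
  shows "(\<theta> / 2 - 1) * Q S u \<le> \<theta> * J S \<epsilon> u - (\<Sum>x\<in>S. DJ \<epsilon> u x * u x) + (\<theta> - 1) * \<epsilon> * Cg * sqrt (Q S u)"
proof -
  have "(\<theta> - 1) * \<epsilon> * (\<Sum>x\<in>S. \<mu> x * g x * u x) \<le> (\<theta> - 1) * \<epsilon> * (Cg * sqrt (Q S u))"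
    using g_bound[of S u] assms \<theta> by (intro mult_left_mono) auto
  moreover have "0 \<le> (\<Sum>x\<in>S. \<mu> x * (u x * f x (u x) - \<theta> * F x (u x)))"
    using AR' \<mu>_pos by (intro sum_nonneg mult_nonneg_nonneg) (auto simp: less_imp_le)
  moreover have "\<theta> * J S \<epsilon> u - (\<Sum>x\<in>S. DJ \<epsilon> u x * u x) = (\<theta> / 2 - 1) * Q S u +
      (\<Sum>x\<in>S. \<mu> x * (u x * f x (u x) - \<theta> * F x (u x))) - (\<theta> - 1) * \<epsilon> * (\<Sum>x\<in>S. \<mu> x * g x * u x)"
    unfolding J_def DJ_def Q_def
    by (simp add: algebra_simps sum.distrib sum_subtractf sum_distrib_left)
  ultimately show ?thesis by simp
qed

text \<open>The bound is independent of \<open>S\<close>. It controls \<open>Q\<close> at critical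
  points and, read backwards, shows that the derivative in direction \<open>u\<close> is negative at
  low levels with large \<open>Q\<close>.\<close>

lemma AR_bound:
  assumes "\<epsilon> \<ge> 0"
  shows "\<exists>K. \<forall>S u. finite S \<longrightarrow> (\<forall>x. x \<notin> S \<longrightarrow> u x = 0) \<longrightarrow> J S \<epsilon> u \<le> C \<longrightarrow>
    0 \<le> (\<Sum>x\<in>S. DJ \<epsilon> u x * u x) \<longrightarrow> Q S u \<le> K"
proof -
  define p b where "p = \<theta> / 2 - 1" and "b = (\<theta> - 1) * \<epsilon> * Cg"
  have p: "p > 0" and b: "b \<ge> 0" using \<theta> assms Cg by (auto simp: p_def b_def)
  \<comment> \<open>Bounds \<open>y = sqrt (Q S u)\<close>: for \<open>y\<close> above 1, divide the
    quadratic inequality for \<open>y\<close> by \<open>y\<close>.\<close>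
  define K where "K = max 1 ((\<theta> * \<bar>C\<bar> + b) / p)"
  show ?thesis
  proof (intro exI[of _ "K\<^sup>2"] allI impI)
    fix S and u :: "'v \<Rightarrow> real"
    assume S: "finite S" and u: "\<forall>x. x \<notin> S \<longrightarrow> u x = 0" and C: "J S \<epsilon> u \<le> C" and D: "0 \<le> (\<Sum>x\<in>S. DJ \<epsilon> u x * u x)"
    define y where "y = sqrt (Q S u)"
    have Q: "0 \<le> Q S u" using S u by (intro Q_nonneg) auto
    then have y: "0 \<le> y" "Q S u = y\<^sup>2" by (auto simp: y_def)
    have "\<theta> * J S \<epsilon> u \<le> \<theta> * \<bar>C\<bar>" using C \<theta> by (intro mult_left_mono) auto
    moreover have "(\<theta> / 2 - 1) * Q S u \<le> \<theta> * J S \<epsilon> u - (\<Sum>x\<in>S. DJ \<epsilon> u x * u x) +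
        (\<theta> - 1) * \<epsilon> * Cg * sqrt (Q S u)"
      using S u assms by (intro AR_energy) auto
    ultimately have *: "p * y\<^sup>2 \<le> \<theta> * \<bar>C\<bar> + b * y"
      using D unfolding y_def[symmetric] p_def b_def by (simp add: y(2))
    have "y \<le> K"
    proof (cases "y \<le> 1")
      case False
      have "\<theta> * \<bar>C\<bar> * 1 \<le> \<theta> * \<bar>C\<bar> * y" using False \<theta> by (intro mult_left_mono) auto
      with * have "(p * y) * y \<le> (\<theta> * \<bar>C\<bar> + b) * y" by (simp add: power2_eq_square algebra_simps)
      then have "p * y \<le> \<theta> * \<bar>C\<bar> + b" using False by simp
      then have "y \<le> (\<theta> * \<bar>C\<bar> + b) / p" using p by (simp add: field_simps)
      then show ?thesis by (simp add: K_def)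
    qed (simp add: K_def)
    then show "Q S u \<le> K\<^sup>2" unfolding y(2) using y(1) by (rule power_mono)
  qed
qed

text \<open>On multiples of the indicator of \<open>x0\<close> the energy is at most a quadratic
  minus a term growing at least like the power \<theta>. All constants depend on \<open>x0\<close>
  only, so the minimax levels are bounded uniformly in \<open>S\<close>.\<close>

lemma ray_bound:
  "\<exists>C. \<forall>S t \<epsilon>. finite S \<longrightarrow> x0 \<in> S \<longrightarrow> t \<ge> 0 \<longrightarrow> \<epsilon> \<ge> 0 \<longrightarrow>
    J S \<epsilon> (\<lambda>x. if x = x0 then t else 0) \<le> C"
proof -
  \<comment> \<open>The value of \<open>Q\<close> at the indicator of \<open>x0\<close>; a loop at
    \<open>x0\<close> contributes nothing.\<close>
  define \<kappa> where "\<kappa> = (\<Sum>y | E x0 y. if y = x0 then 0 else w x0 y) + \<mu> x0 * h x0"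
  define b where "b = \<mu> x0 * F x0 1"
  have b: "b > 0" using \<mu>_pos F_pos by (simp add: b_def)
  have "0 \<le> (\<Sum>y | E x0 y. if y = x0 then 0 else w x0 y)"
    using w_pos by (intro sum_nonneg) (auto simp: less_imp_le)
  then have \<kappa>: "\<kappa> > 0" using \<mu>_pos[of x0] h_pos[of x0] by (simp add: \<kappa>_def add_nonneg_pos)
  \<comment> \<open>Beyond this point the superlinear term outweighs the quadratic one.\<close>
  define T where "T = max 1 ((\<kappa> / (2 * b)) powr (1 / (\<theta> - 2)))"
  have T: "T \<ge> 1" by (simp add: T_def)
  show ?thesis
  proof (intro exI[of _ "\<kappa> * T\<^sup>2 / 2"] allI impI)
    fix S and t \<epsilon> :: real assume S: "finite S" "x0 \<in> S" and t: "t \<ge> 0" and \<epsilon>: "\<epsilon> \<ge> 0"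
    let ?u = "\<lambda>x. if x = x0 then t else 0"
    have single: "(\<Sum>x\<in>S. if x = x0 then k else 0) = k" for k :: real using S by simp
    have "\<mu> x0 * L ?u x0 = t * \<kappa>"
    proof -
      have "(\<Sum>y | E x0 y. w x0 y * (?u x0 - ?u y)) = (\<Sum>y | E x0 y. t * (if y = x0 then 0 else w x0 y))"
        by (intro sum.cong) auto
      then show ?thesis unfolding \<mu>_L \<kappa>_def by (simp add: sum_distrib_left algebra_simps)
    qed
    moreover have "Q S ?u = (\<Sum>x\<in>S. if x = x0 then t * (\<mu> x0 * L ?u x0) else 0)"
      unfolding Q_def by (intro sum.cong) auto
    ultimately have Q: "Q S ?u = \<kappa> * t\<^sup>2" unfolding single by (simp add: power2_eq_square)
    have "(\<Sum>x\<in>S. \<mu> x * F x (?u x)) = (\<Sum>x\<in>S. if x = x0 then \<mu> x0 * F x0 t else 0)"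
      using F_neg[of 0] by (intro sum.cong) auto
    then have Fs: "(\<Sum>x\<in>S. \<mu> x * F x (?u x)) = \<mu> x0 * F x0 t" unfolding single .
    have "0 \<le> \<epsilon> * (\<Sum>x\<in>S. \<mu> x * g x * ?u x)"
      using \<epsilon> t g_nonneg \<mu>_pos by (intro mult_nonneg_nonneg sum_nonneg) (auto simp: less_imp_le)
    then have J: "J S \<epsilon> ?u \<le> \<kappa> * t\<^sup>2 / 2 - \<mu> x0 * F x0 t" unfolding J_def Q Fs by simp
    show "J S \<epsilon> ?u \<le> \<kappa> * T\<^sup>2 / 2"
    proof (cases "t \<le> T")
      case True
      then have "\<kappa> * t\<^sup>2 / 2 \<le> \<kappa> * T\<^sup>2 / 2" using t \<kappa> by (simp add: power_mono)
      then show ?thesis using J F_nonneg[of x0 t] \<mu>_pos[of x0] by (smt (verit) mult_nonneg_nonneg)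
    next
      case False
      then have t1: "1 \<le> t" "0 < t" using T by auto
      have "\<kappa> / (2 * b) = ((\<kappa> / (2 * b)) powr (1 / (\<theta> - 2))) powr (\<theta> - 2)"
        using \<theta> \<kappa> b by (simp add: powr_powr)
      also have "\<dots> \<le> t powr (\<theta> - 2)"
        using False \<theta> by (intro powr_mono2) (auto simp: T_def)
      finally have "\<kappa> / 2 \<le> b * t powr (\<theta> - 2)" using b by (simp add: field_simps)
      then have "\<kappa> / 2 * t\<^sup>2 \<le> b * t powr (\<theta> - 2) * t\<^sup>2" by (intro mult_right_mono) auto
      also have "\<dots> = \<mu> x0 * (F x0 1 * t powr \<theta>)" using powr_split[OF t1(2)] by (simp add: b_def)
      also have "\<dots> \<le> \<mu> x0 * F x0 t"
        using F_powr_mono[of 1 t x0] t1 \<mu>_pos[of x0] by (intro mult_left_mono) auto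
      finally have "J S \<epsilon> ?u \<le> 0" using J by simp
      also have "0 \<le> \<kappa> * T\<^sup>2 / 2" using \<kappa> by simp
      finally show ?thesis .
    qed
  qed
qed

text \<open>Minimum principle: at a negative minimum \<open>L u\<close> is negative, but the cut-off
  removes \<open>f\<close> there, so \<open>L u = \<epsilon> * g\<close> is nonnegative.\<close>

lemma critical_nonneg:
  assumes S: "finite S" "\<And>x. x \<notin> S \<Longrightarrow> u x = 0" and \<epsilon>: "\<epsilon> \<ge> 0"
    and crit: "\<And>x. x \<in> S \<Longrightarrow> DJ \<epsilon> u x = 0"
  shows "u x \<ge> 0"
proof (rule ccontr)
  assume neg: "\<not> u x \<ge> 0"
  then have "x \<in> S" using S(2) by force
  define z where "z = arg_min_on u S"
  have z: "z \<in> S" "\<And>y. y \<in> S \<Longrightarrow> u z \<le> u y"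
    unfolding z_def using S(1) \<open>x \<in> S\<close> by (auto intro: arg_min_if_finite arg_min_least)
  then have uz: "u z < 0" using neg \<open>x \<in> S\<close> by fastforce
  \<comment> \<open>As \<open>u\<close> is 0 off \<open>S\<close>, the negative minimum over
    \<open>S\<close> is a minimum over all vertices.\<close>
  have min: "u z \<le> u y" for y using z(2)[of y] S(2)[of y] uz by (cases "y \<in> S") auto
  have "(\<Sum>y | E z y. w z y * (u z - u y)) \<le> 0"
    using min w_pos by (intro sum_nonpos mult_nonneg_nonpos) (auto simp: less_imp_le)
  moreover have "\<mu> z * h z * u z < 0"
    using uz \<mu>_pos h_pos by (simp add: mult_pos_neg)
  ultimately have "\<mu> z * L u z < 0" unfolding \<mu>_L by linarith
  moreover have "L u z = \<epsilon> * g z"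
    using crit[OF z(1)] f_neg[of "u z" z] uz \<mu>_pos[of z] by (simp add: DJ_def)
  ultimately show False using \<epsilon> g_nonneg[of z] \<mu>_pos[of z] by (simp add: mult_less_0_iff not_less)
qed

text \<open>Testing the equation with \<open>u\<close> itself expresses \<open>Q S u\<close> by
  \<open>f\<close> and \<open>g\<close>; substitute this in the energy.\<close>

lemma critical_J:
  assumes "\<And>x. x \<in> S \<Longrightarrow> DJ \<epsilon> u x = 0"
  shows "J S \<epsilon> u = (\<Sum>x\<in>S. \<Phi> x (u x)) - \<epsilon> / 2 * (\<Sum>x\<in>S. \<mu> x * g x * u x)"
proof -
  have "(\<Sum>x\<in>S. \<Phi> x (u x)) = (\<Sum>x\<in>S. \<mu> x * u x * f x (u x) / 2 - \<mu> x * F x (u x))"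
    unfolding \<Phi>_def by (intro sum.cong) (simp_all add: algebra_simps)
  also have "\<dots> = (\<Sum>x\<in>S. \<mu> x * u x * f x (u x)) / 2 - (\<Sum>x\<in>S. \<mu> x * F x (u x))"
    by (simp add: sum_subtractf sum_divide_distrib)
  finally have "(\<Sum>x\<in>S. \<Phi> x (u x)) = (\<Sum>x\<in>S. \<mu> x * u x * f x (u x)) / 2 - (\<Sum>x\<in>S. \<mu> x * F x (u x))" .
  moreover have "Q S u = (\<Sum>x\<in>S. \<mu> x * u x * f x (u x) + \<epsilon> * (\<mu> x * g x * u x))"
    unfolding Q_def
  proof (rule sum.cong[OF refl])
    fix x assume "x \<in> S"
    then have "L u x = f x (u x) + \<epsilon> * g x" using assms[of x] \<mu>_pos[of x] by (simp add: DJ_def)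
    then show "\<mu> x * u x * L u x = \<mu> x * u x * f x (u x) + \<epsilon> * (\<mu> x * g x * u x)"
      by (simp add: algebra_simps)
  qed
  then have "Q S u = (\<Sum>x\<in>S. \<mu> x * u x * f x (u x)) + \<epsilon> * (\<Sum>x\<in>S. \<mu> x * g x * u x)"
    by (simp add: sum.distrib sum_distrib_left)
  ultimately show ?thesis
    by (simp add: J_def field_simps)
qed

subsection \<open>Critical points on finite vertex sets\<close>

text \<open>Of the quadratic term \<open>r\<^sup>2 / 2\<close>, the primitive takes at most half and
  the linear term at most \<open>r\<^sup>2 / 8\<close>.\<close>

lemma mountain_ring:
  assumes r: "small_radius r"
    and \<epsilon>: "\<epsilon> \<ge> 0" "\<epsilon> * Cg \<le> r / 8"
    and S: "finite S" "\<And>x. x \<notin> S \<Longrightarrow> u x = 0" and Q: "Q S u = r\<^sup>2"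
  shows "r\<^sup>2 / 8 \<le> J S \<epsilon> u"
proof -
  have "\<epsilon> * (\<Sum>x\<in>S. \<mu> x * g x * u x) \<le> \<epsilon> * (Cg * sqrt (Q S u))"
    using g_bound[of S u] S \<epsilon>(1) by (intro mult_left_mono) auto
  also have "\<dots> = \<epsilon> * Cg * r" using Q small_radius_pos[OF r] by simp
  also have "\<dots> \<le> r / 8 * r" using \<epsilon>(2) small_radius_pos[OF r] by (intro mult_right_mono) auto
  finally have "\<epsilon> * (\<Sum>x\<in>S. \<mu> x * g x * u x) \<le> r\<^sup>2 / 8" by (simp add: power2_eq_square)
  moreover have "(\<Sum>x\<in>S. \<mu> x * F x (u x)) \<le> r\<^sup>2 / 4" using small_radiusD[OF r S(1), of u] S(2) Q by simp
  ultimately show ?thesis unfolding J_def Q by linarith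
qed

lemma mountain_pass_critical:
  assumes r: "small_radius r"
    and \<epsilon>: "\<epsilon> \<ge> 0" "\<epsilon> * Cg \<le> r / 8"
  shows "\<exists>K. \<forall>S. finite S \<longrightarrow> x0 \<in> S \<longrightarrow> (\<exists>u. (\<forall>x. x \<notin> S \<longrightarrow> u x = 0) \<and>
    (\<forall>x\<in>S. DJ \<epsilon> u x = 0) \<and> Q S u \<le> K \<and> r\<^sup>2 / 8 \<le> J S \<epsilon> u)"
proof -
  obtain C where C: "\<forall>S t \<epsilon>. finite S \<longrightarrow> x0 \<in> S \<longrightarrow> t \<ge> 0 \<longrightarrow> \<epsilon> \<ge> 0 \<longrightarrow>
    J S \<epsilon> (\<lambda>x. if x = x0 then t else 0) \<le> C"
    using ray_bound[of x0] ..
  obtain K where K: "\<forall>S u. finite S \<longrightarrow> (\<forall>x. x \<notin> S \<longrightarrow> u x = 0) \<longrightarrow> J S \<epsilon> u \<le> C + 1 \<longrightarrow>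
    0 \<le> (\<Sum>x\<in>S. DJ \<epsilon> u x * u x) \<longrightarrow> Q S u \<le> K"
    using AR_bound[OF \<epsilon>(1), of "C + 1"] ..
  \<comment> \<open>By \<open>L2_le_Q\<close>, on this sphere \<open>Q\<close> exceeds both
    \<open>K\<close>, which gives the outward condition by \<open>AR_bound\<close>, and
    \<open>r\<^sup>2\<close>, so that paths to the sphere cross the ring. The radius does not depend
    on \<open>S\<close>.\<close>
  define R where "R = sqrt ((max K (r\<^sup>2) + 1) / (\<mu>min * h0))"
  have mh: "\<mu>min * h0 > 0" using \<mu>min(1) h0(1) by simp
  have mpos: "max K (r\<^sup>2) + 1 > 0" using small_radius_pos[OF r] by (smt (verit) zero_le_power2)
  have R: "R > 0" "\<mu>min * h0 * R\<^sup>2 = max K (r\<^sup>2) + 1"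
    unfolding R_def using mh mpos by (auto simp: divide_pos_pos)
  have "\<exists>u. (\<forall>x. x \<notin> S \<longrightarrow> u x = 0) \<and> (\<forall>x\<in>S. DJ \<epsilon> u x = 0) \<and> Q S u \<le> K \<and> r\<^sup>2 / 8 \<le> J S \<epsilon> u"
    if S: "finite S" "x0 \<in> S" for S
  proof -
    have Q_sphere: "max K (r\<^sup>2) < Q S u" if "u \<in> fball S R" "L2_set u S = R" for u
      using L2_le_Q[OF S(1), of u] that R(2) by (auto simp: fball_def)
    have out: "(\<Sum>x\<in>S. DJ \<epsilon> u x * u x) \<le> 0"
      if "u \<in> fball S R" "L2_set u S = R" "J S \<epsilon> u \<le> C + 1" for u
    proof (rule ccontr)
      assume "\<not> (\<Sum>x\<in>S. DJ \<epsilon> u x * u x) \<le> 0"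
      then have "Q S u \<le> K" using that by (intro K[rule_format, OF S(1)]) (auto simp: fball_def)
      then show False using Q_sphere[OF that(1,2)] by simp
    qed
    obtain u where u: "u \<in> fball S R" "\<And>x. x \<in> S \<Longrightarrow> DJ \<epsilon> u x = 0" "r\<^sup>2 / 8 \<le> J S \<epsilon> u" "J S \<epsilon> u \<le> C"
    proof (rule finite_mountain_pass[of S x0 R "J S \<epsilon>" "DJ \<epsilon>" "C + 1" "Q S" "r\<^sup>2" "r\<^sup>2 / 8" C])
      show "Q S (\<lambda>_. 0) \<le> r\<^sup>2" by (simp add: Q_def)
      show "J S \<epsilon> (\<lambda>_. 0) < r\<^sup>2 / 8" using small_radius_pos[OF r] by (simp add: J_0)
      show "r\<^sup>2 \<le> Q S u" if "u \<in> fball S R" "L2_set u S = R" for u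
        using Q_sphere[OF that] by simp
      show "r\<^sup>2 / 8 \<le> J S \<epsilon> u" if "u \<in> fball S R" "Q S u = r\<^sup>2" for u
        using mountain_ring[OF r \<epsilon> S(1), of u] that by (auto simp: fball_def)
      show "J S \<epsilon> (\<lambda>x. if x = x0 then t else 0) \<le> C" if "0 \<le> t" for t
        using C S that \<epsilon>(1) by simp
    qed (use S R(1) out continuous_on_J continuous_on_DJ continuous_on_Q J_step[OF S(1)] that in auto)
    moreover have "Q S u \<le> K"
      using u by (intro K[rule_format, OF S(1)]) (auto simp: fball_def)
    ultimately show ?thesis by (intro exI[of _ u]) (simp add: fball_def)
  qed
  then show ?thesis by (intro exI[of _ K] allI impI)
qed

text \<open>Minimise the energy over \<open>Q S u \<le> r\<^sup>2\<close>. The value at 0 is 0 and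
  the boundary values are at least \<open>r\<^sup>2 / 8\<close>, so the minimiser is interior and
  hence critical.\<close>

lemma local_min_critical:
  assumes r: "small_radius r"
    and \<epsilon>: "\<epsilon> \<ge> 0" "\<epsilon> * Cg \<le> r / 8"
    and S: "finite S"
  shows "\<exists>u. (\<forall>x. x \<notin> S \<longrightarrow> u x = 0) \<and> (\<forall>x\<in>S. DJ \<epsilon> u x = 0) \<and> Q S u \<le> r\<^sup>2 \<and> J S \<epsilon> u \<le> 0"
proof -
  define R where "R = r / sqrt (\<mu>min * h0)"
  have mh: "\<mu>min * h0 > 0" using \<mu>min(1) h0(1) by simp
  have R: "R > 0" "\<mu>min * h0 * R\<^sup>2 = r\<^sup>2"
    using mh small_radius_pos[OF r] \<mu>min(1) h0(1) by (auto simp: R_def power_divide)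
  have in_ball: "u \<in> fball S R" if "\<And>x. x \<notin> S \<Longrightarrow> u x = 0" "Q S u \<le> r\<^sup>2" for u
  proof -
    have "\<mu>min * h0 * (L2_set u S)\<^sup>2 \<le> \<mu>min * h0 * R\<^sup>2"
      using L2_le_Q[OF S, of u] that R(2) by auto
    then have "(L2_set u S)\<^sup>2 \<le> R\<^sup>2" using mult_le_cancel_left_pos[OF mh] by blast
    then have "L2_set u S \<le> R" by (rule power2_le_imp_le) (use R in simp)
    then show ?thesis using that by (simp add: fball_def)
  qed
  have "closed {u. Q S u \<le> r\<^sup>2}" by (intro closed_Collect_le continuous_on_Q continuous_on_const)
  then have "compact (fball S R \<inter> {u. Q S u \<le> r\<^sup>2})"
    by (intro compact_Int_closed compact_fball S)
  moreover have zero: "(\<lambda>_. 0) \<in> fball S R \<inter> {u. Q S u \<le> r\<^sup>2}"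
    using R(1) by (auto simp: fball_def Q_def L2_set_def)
  moreover have "continuous_on (fball S R \<inter> {u. Q S u \<le> r\<^sup>2}) (J S \<epsilon>)"
    using continuous_on_J continuous_on_subset by blast
  ultimately obtain u where u: "u \<in> fball S R \<inter> {u. Q S u \<le> r\<^sup>2}"
    "\<And>v. v \<in> fball S R \<inter> {u. Q S u \<le> r\<^sup>2} \<Longrightarrow> J S \<epsilon> u \<le> J S \<epsilon> v"
    using continuous_attains_inf[of "fball S R \<inter> {u. Q S u \<le> r\<^sup>2}" "J S \<epsilon>"] by blast
  have J: "J S \<epsilon> u \<le> 0" using u(2)[OF zero] by (simp add: J_0)
  have u0: "\<And>x. x \<notin> S \<Longrightarrow> u x = 0" using u(1) by (auto simp: fball_def)
  have Q: "Q S u < r\<^sup>2"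
  proof (rule ccontr)
    assume "\<not> Q S u < r\<^sup>2"
    then have "Q S u = r\<^sup>2" using u(1) by simp
    then have "r\<^sup>2 / 8 \<le> J S \<epsilon> u" using mountain_ring[OF r \<epsilon> S, of u] u0 by blast
    then show False using J zero_less_power[OF small_radius_pos[OF r], of 2] by linarith
  qed
  have "DJ \<epsilon> u x = 0" if "x \<in> S" for x
  proof (rule ccontr)
    assume "DJ \<epsilon> u x \<noteq> 0"
    define n where "n = L2_set (DJ \<epsilon> u) S"
    have n: "n > 0" using abs_le_L2_set[OF S \<open>x \<in> S\<close>, of "DJ \<epsilon> u"] \<open>DJ \<epsilon> u x \<noteq> 0\<close> by (simp add: n_def)
    obtain \<tau> where \<tau>: "\<tau> > 0" "\<And>v. (\<forall>x. x \<notin> S \<longrightarrow> v x = 0) \<Longrightarrow> L2_set (\<lambda>x. v x - u x) S \<le> \<tau> \<Longrightarrow>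
        J S \<epsilon> v \<le> J S \<epsilon> u + (\<Sum>x\<in>S. DJ \<epsilon> u x * (v x - u x)) + n / 2 * L2_set (\<lambda>x. v x - u x) S"
      using J_step[OF S half_gt_zero[OF n], of R \<epsilon>] u(1) by auto
    \<comment> \<open>A short step against the gradient: it keeps \<open>Q\<close> below
      \<open>r\<^sup>2\<close> by continuity and lowers the energy, against minimality.\<close>
    define v where "v s x = (if x \<in> S then u x - s * DJ \<epsilon> u x else 0)" for s x
    have "v 0 = u" using u0 by (auto simp: v_def)
    have "continuous_on UNIV v"
    proof (rule continuous_on_coordinatewise_then_product)
      show "continuous_on UNIV (\<lambda>s. v s x)" for x
        by (cases "x \<in> S") (auto simp: v_def intro!: continuous_intros)
    qed
    then have "continuous_on UNIV (\<lambda>s. Q S (v s))"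
      by (rule continuous_on_compose2[OF continuous_on_Q]) auto
    then have "isCont (\<lambda>s. Q S (v s)) 0" by (simp add: continuous_on_eq_continuous_at)
    then have "((\<lambda>s. Q S (v s)) \<longlongrightarrow> Q S u) (at_right 0)"
      using \<open>v 0 = u\<close> by (metis isCont_def filterlim_at_split)
    then have "\<forall>\<^sub>F s in at_right 0. Q S (v s) < r\<^sup>2" using Q by (rule order_tendstoD)
    moreover have "\<forall>\<^sub>F s in at_right 0. s \<in> {0<..<\<tau> / n}"
      using \<tau> n by (intro eventually_at_right_real divide_pos_pos) auto
    ultimately have "\<forall>\<^sub>F s in at_right 0. Q S (v s) < r\<^sup>2 \<and> s \<in> {0<..<\<tau> / n}"
      by (rule eventually_conj)
    then obtain s where s: "Q S (v s) < r\<^sup>2" "s < \<tau> / n" "0 < s"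
      using eventually_happens'[of "at_right (0::real)"] by auto
    have "L2_set (\<lambda>x. v s x - u x) S = L2_set (\<lambda>x. s * DJ \<epsilon> u x) S"
      by (subst L2_set_minus_commute) (auto simp: v_def intro!: L2_set_cong)
    then have dist: "L2_set (\<lambda>x. v s x - u x) S = s * n"
      using s(3) by (simp add: n_def L2_set_right_distrib)
    have "J S \<epsilon> (v s) \<le> J S \<epsilon> u + (\<Sum>x\<in>S. DJ \<epsilon> u x * (v s x - u x)) + n / 2 * (s * n)"
      unfolding dist[symmetric]
    proof (rule \<tau>(2))
      show "\<forall>x. x \<notin> S \<longrightarrow> v s x = 0" by (simp add: v_def)
      show "L2_set (\<lambda>x. v s x - u x) S \<le> \<tau>" unfolding dist using s n by (simp add: field_simps)
    qed
    also have "(\<Sum>x\<in>S. DJ \<epsilon> u x * (v s x - u x)) = - s * (\<Sum>x\<in>S. (DJ \<epsilon> u x)\<^sup>2)"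
      unfolding sum_distrib_left by (intro sum.cong) (auto simp: v_def power2_eq_square)
    also have "(\<Sum>x\<in>S. (DJ \<epsilon> u x)\<^sup>2) = n\<^sup>2" by (simp add: n_def L2_set_power2)
    finally have "J S \<epsilon> (v s) \<le> J S \<epsilon> u - s * n\<^sup>2 / 2" by (simp add: power2_eq_square algebra_simps)
    moreover have "s * n\<^sup>2 > 0" using s n by simp
    ultimately have "J S \<epsilon> (v s) < J S \<epsilon> u" by linarith
    moreover have "v s \<in> fball S R \<inter> {u. Q S u \<le> r\<^sup>2}"
      using in_ball[of "v s"] s(1) by (auto simp: v_def)
    ultimately show False using u(2)[of "v s"] by simp
  qed
  then show ?thesis using u0 Q J by (intro exI[of _ u]) auto
qed

subsection \<open>Passage to the limit\<close>

text \<open>A summable family with all terms nonzero has a countable index set.\<close>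

lemma countable_vertices: "countable (UNIV :: 'v set)"
proof -
  have "countable {x \<in> UNIV. \<mu> x / h x \<noteq> 0}"
    using summable_countable_real[OF h_inv] by simp
  moreover have "{x \<in> UNIV. \<mu> x / h x \<noteq> 0} = UNIV"
    using \<mu>_pos h_pos by (auto simp: less_imp_neq[symmetric])
  ultimately show ?thesis by simp
qed

text \<open>The solution is extended by 0 off \<open>U\<close>. When \<open>U\<close> is a
  component, no edge leaves it and the extension does not affect the equation.\<close>

definition solves_on :: "'v set \<Rightarrow> real \<Rightarrow> ('v \<Rightarrow> real) \<Rightarrow> bool" where
  "solves_on U \<epsilon> u \<longleftrightarrow> (\<forall>x. u x \<ge> 0) \<and> (\<forall>x. x \<notin> U \<longrightarrow> u x = 0) \<and> (\<forall>x\<in>U. L u x = f x (u x) + \<epsilon> * g x)"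

text \<open>The bound on \<open>Q\<close> bounds the values pointwise and a diagonal subsequence
  converges; as \<open>L u x\<close> involves finitely many vertices, the equation passes to the
  limit. The sequence is returned too, because \<open>P\<close> need not survive the limit.\<close>

lemma exhaustion_limit:
  fixes P :: "'v set \<Rightarrow> ('v \<Rightarrow> real) \<Rightarrow> bool"
  assumes U: "x0 \<in> U" and \<epsilon>: "\<epsilon> \<ge> 0"
    and ex: "\<forall>S. finite S \<longrightarrow> x0 \<in> S \<longrightarrow> (\<exists>u. (\<forall>x. x \<notin> S \<longrightarrow> u x = 0) \<and>
      (\<forall>x\<in>S. DJ \<epsilon> u x = 0) \<and> Q S u \<le> K \<and> P S u)"
  shows "\<exists>V un u. (\<forall>n::nat. finite (V n) \<and> (\<forall>x. x \<notin> V n \<longrightarrow> un n x = 0) \<and>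
      (\<forall>x\<in>V n. DJ \<epsilon> (un n) x = 0) \<and> (\<forall>x. un n x \<ge> 0) \<and> Q (V n) (un n) \<le> K \<and> P (V n) (un n)) \<and>
    (\<forall>x. (\<lambda>n. un n x) \<longlonglongrightarrow> u x) \<and> solves_on U \<epsilon> u"
proof -
  \<comment> \<open>An exhaustion of \<open>U\<close> by finite sets that always contain
    \<open>x0\<close>.\<close>
  define V where "V n = insert x0 (from_nat_into U ` {..n})" for n :: nat
  have cU: "countable U" by (rule countable_subset[OF subset_UNIV countable_vertices])
  have V: "finite (V n)" "x0 \<in> V n" "V n \<subseteq> U" for n
    using U from_nat_into[of U] by (auto simp: V_def)
  have V_ev: "\<exists>N. \<forall>n\<ge>N. x \<in> V n" if x: "x \<in> U" for x
  proof -
    obtain m where "x = from_nat_into U m" using from_nat_into_surj[OF cU x] by metis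
    then show ?thesis by (intro exI[of _ m]) (auto simp: V_def)
  qed
  have "\<exists>u. (\<forall>x. x \<notin> V n \<longrightarrow> u x = 0) \<and> (\<forall>x\<in>V n. DJ \<epsilon> u x = 0) \<and> Q (V n) u \<le> K \<and> P (V n) u" for n
    using ex[rule_format, OF V(1,2)] .
  then obtain un where un: "\<And>n. (\<forall>x. x \<notin> V n \<longrightarrow> un n x = 0) \<and> (\<forall>x\<in>V n. DJ \<epsilon> (un n) x = 0) \<and>
      Q (V n) (un n) \<le> K \<and> P (V n) (un n)" by metis
  have nonneg: "un n x \<ge> 0" for n x
    using un[of n] by (intro critical_nonneg[OF V(1)[of n] _ \<epsilon>]) auto
  have bd: "norm (un n x) \<le> sqrt (K / (\<mu>min * h0))" for n x
  proof -
    have mh: "\<mu>min * h0 > 0" using \<mu>min(1) h0(1) by simp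
    have "\<mu>min * h0 * (un n x)\<^sup>2 \<le> K"
      using le_Q_pointwise[OF V(1)[of n], of "un n" x] un[of n] by fastforce
    then have "(un n x)\<^sup>2 \<le> K / (\<mu>min * h0)" using mh by (simp add: field_simps)
    then show ?thesis by (metis real_norm_def real_sqrt_abs real_sqrt_le_iff)
  qed
  have "\<exists>k. strict_mono (k :: nat \<Rightarrow> nat) \<and> (\<forall>x. \<exists>l. (\<lambda>n. un (k n) x) \<longlonglongrightarrow> l)"
  proof (rule function_convergent_subsequence[OF countable_vertices, of un "sqrt (K / (\<mu>min * h0))", OF bd])
    fix k :: "nat \<Rightarrow> nat"
    assume "strict_mono k" "\<And>x. x \<in> UNIV \<Longrightarrow> \<exists>l. (\<lambda>n. un (k n) x) \<longlonglongrightarrow> l"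
    then show ?thesis by auto
  qed
  then obtain k where k: "strict_mono k" "\<forall>x. \<exists>l. (\<lambda>n. un (k n) x) \<longlonglongrightarrow> l" by blast
  define u where "u x = lim (\<lambda>n. un (k n) x)" for x
  have u: "(\<lambda>n. un (k n) x) \<longlonglongrightarrow> u x" for x
    using k(2)[rule_format, of x] by (simp add: u_def convergent_LIMSEQ_iff[symmetric] convergent_def)
  have "solves_on U \<epsilon> u"
    unfolding solves_on_def
  proof (intro conjI allI impI ballI)
    show "u x \<ge> 0" for x
      using LIMSEQ_le_const[OF u[of x]] nonneg by blast
    show "u x = 0" if "x \<notin> U" for x
    proof -
      have "un (k n) x = 0" for n using that V(3)[of "k n"] un[of "k n"] by blast
      then show ?thesis using u[of x] by (simp add: LIMSEQ_const_iff)
    qed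
    fix x assume x: "x \<in> U"
    obtain N where N: "\<forall>n\<ge>N. x \<in> V n" using V_ev[OF x] by blast
    have lim_L: "(\<lambda>n. L (un (k n)) x) \<longlonglongrightarrow> L u x"
      unfolding L_def laplacian_def by (intro tendsto_intros u)
    have lim_f: "(\<lambda>n. f x (un (k n) x) + \<epsilon> * g x) \<longlonglongrightarrow> f x (u x) + \<epsilon> * g x"
    proof -
      have "isCont (f x) (u x)" using f_cont by (simp add: continuous_on_eq_continuous_at)
      then show ?thesis by (intro tendsto_intros isCont_tendsto_compose[OF _ u])
    qed
    have "\<forall>\<^sub>F n in sequentially. L (un (k n)) x = f x (un (k n) x) + \<epsilon> * g x"
    proof (rule eventually_sequentiallyI[of N])
      fix n assume "N \<le> n"
      then have "x \<in> V (k n)" using N seq_suble[OF k(1), of n] by simp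
      then have "DJ \<epsilon> (un (k n)) x = 0" using un by blast
      then show "L (un (k n)) x = f x (un (k n) x) + \<epsilon> * g x"
        using \<mu>_pos[of x] by (simp add: DJ_def)
    qed
    from tendsto_cong[OF this] lim_f have "(\<lambda>n. L (un (k n)) x) \<longlonglongrightarrow> f x (u x) + \<epsilon> * g x"
      by blast
    with lim_L show "L u x = f x (u x) + \<epsilon> * g x" by (rule LIMSEQ_unique)
  qed
  then show ?thesis
    using V(1) un nonneg u
    by (intro exI[of _ "\<lambda>n. V (k n)"] exI[of _ "\<lambda>n. un (k n)"] exI[of _ u]) simp
qed

lemma \<Phi>_nonneg: "\<Phi> x s \<ge> 0"
proof -
  have "2 * F x s \<le> \<theta> * F x s" using \<theta> F_nonneg by (intro mult_right_mono) auto
  then show ?thesis using AR'[of x s] \<mu>_pos[of x] by (simp add: \<Phi>_def)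
qed

lemma \<Phi>_0: "\<Phi> x 0 = 0" using F_neg[of 0] by (simp add: \<Phi>_def)

lemma \<Phi>_tendsto: "s \<longlonglongrightarrow> l \<Longrightarrow> (\<lambda>n. \<Phi> x (s n)) \<longlonglongrightarrow> \<Phi> x l"
proof -
  assume s: "s \<longlonglongrightarrow> l"
  have "isCont (f x) l" "isCont (F x) l"
    using f_cont F_cont by (simp_all add: continuous_on_eq_continuous_at)
  then have "(\<lambda>n. f x (s n)) \<longlonglongrightarrow> f x l" "(\<lambda>n. F x (s n)) \<longlonglongrightarrow> F x l"
    using s isCont_tendsto_compose by blast+
  then show ?thesis unfolding \<Phi>_def by (intro tendsto_intros s) auto
qed

lemma tail_small:
  assumes "e > 0"
  shows "\<exists>T. finite T \<and> (\<forall>S. finite S \<longrightarrow> S \<inter> T = {} \<longrightarrow> (\<Sum>x\<in>S. \<mu> x / h x) \<le> e)"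
proof -
  obtain T where T: "finite T" "dist (\<Sum>x\<in>T. \<mu> x / h x) (\<Sum>\<^sub>\<infinity>x. \<mu> x / h x) \<le> e"
    using infsum_finite_approximation[OF h_inv assms] by blast
  show ?thesis
  proof (intro exI[of _ T] conjI allI impI T(1))
    fix S assume S: "finite S" "S \<inter> T = {}"
    have "(\<Sum>x\<in>S \<union> T. \<mu> x / h x) \<le> (\<Sum>\<^sub>\<infinity>x. \<mu> x / h x)"
      using S T \<mu>_pos h_pos by (intro finite_sum_le_infsum h_inv) (auto simp: less_imp_le)
    then show "(\<Sum>x\<in>S. \<mu> x / h x) \<le> e"
      using S T by (auto simp: sum.union_disjoint dist_real_def)
  qed
qed

text \<open>Cauchy-Schwarz after splitting \<open>\<mu>\<close> as
  \<open>sqrt (\<mu> / h) * sqrt (\<mu> * h)\<close>. With \<open>1 / h\<close> summable it makes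
  tails small uniformly for bounded \<open>Q\<close>.\<close>

lemma L1_le_Q:
  assumes "finite S" "\<And>x. x \<notin> S \<Longrightarrow> u x = 0" "T \<subseteq> S"
  shows "(\<Sum>x\<in>T. \<mu> x * u x) \<le> sqrt (\<Sum>x\<in>T. \<mu> x / h x) * sqrt (Q S u)"
proof -
  have "(\<Sum>x\<in>T. \<mu> x * u x) = (\<Sum>x\<in>T. sqrt (\<mu> x / h x) * (sqrt (\<mu> x * h x) * u x))"
  proof (rule sum.cong[OF refl])
    fix x
    have "sqrt (\<mu> x / h x) * sqrt (\<mu> x * h x) = \<mu> x"
      using \<mu>_pos[of x] h_pos[of x] by (simp add: real_sqrt_mult[symmetric])
    then show "\<mu> x * u x = sqrt (\<mu> x / h x) * (sqrt (\<mu> x * h x) * u x)" by (metis mult.assoc)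
  qed
  also have "\<dots> \<le> L2_set (\<lambda>x. sqrt (\<mu> x / h x)) T * L2_set (\<lambda>x. sqrt (\<mu> x * h x) * u x) T"
    by (rule sum_mult_le_L2_set)
  also have "L2_set (\<lambda>x. sqrt (\<mu> x / h x)) T = sqrt (\<Sum>x\<in>T. \<mu> x / h x)"
    using \<mu>_pos h_pos by (simp add: L2_set_def less_imp_le)
  also have "L2_set (\<lambda>x. sqrt (\<mu> x * h x) * u x) T = sqrt (\<Sum>x\<in>T. \<mu> x * h x * (u x)\<^sup>2)"
    using \<mu>_pos h_pos by (simp add: L2_set_def power_mult_distrib less_imp_le)
  also have "sqrt (\<Sum>x\<in>T. \<mu> x / h x) * sqrt (\<Sum>x\<in>T. \<mu> x * h x * (u x)\<^sup>2) \<le>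
      sqrt (\<Sum>x\<in>T. \<mu> x / h x) * sqrt (Q S u)"
  proof -
    have "(\<Sum>x\<in>T. \<mu> x * h x * (u x)\<^sup>2) \<le> (\<Sum>x\<in>S. \<mu> x * h x * (u x)\<^sup>2)"
      using assms \<mu>_pos h_pos by (intro sum_mono2) (auto simp: less_imp_le)
    also have "\<dots> \<le> Q S u" using assms(1,2) by (rule Q_ge)
    finally have "sqrt (\<Sum>x\<in>T. \<mu> x * h x * (u x)\<^sup>2) \<le> sqrt (Q S u)" by simp
    moreover have "0 \<le> (\<Sum>x\<in>T. \<mu> x / h x)" using \<mu>_pos h_pos by (intro sum_nonneg) (auto simp: less_imp_le)
    ultimately show ?thesis by (intro mult_left_mono) auto
  qed
  finally show ?thesis .
qed

text \<open>The sums of \<open>\<Phi>\<close> over \<open>V n\<close> are at least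
  \<open>r\<^sup>2 / 8\<close>. Outside a fixed finite \<open>T\<close> at most
  \<open>r\<^sup>2 / 32\<close> is lost, so the bound on \<open>T\<close> survives pointwise limits
  and the limit is not 0.\<close>

lemma mountain_pass_solution:
  assumes r: "small_radius r"
    and \<epsilon>: "\<epsilon> \<ge> 0" "\<epsilon> * Cg \<le> r / 8" and U: "x0 \<in> U"
  obtains u T where "solves_on U \<epsilon> u" "finite T" "r\<^sup>2 * 3 / 32 \<le> (\<Sum>x\<in>T. \<Phi> x (u x))"
proof -
  obtain K where K: "\<forall>S. finite S \<longrightarrow> x0 \<in> S \<longrightarrow> (\<exists>u. (\<forall>x. x \<notin> S \<longrightarrow> u x = 0) \<and>
    (\<forall>x\<in>S. DJ \<epsilon> u x = 0) \<and> Q S u \<le> K \<and> r\<^sup>2 / 8 \<le> J S \<epsilon> u)"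
    using mountain_pass_critical[OF r \<epsilon>, of x0] ..
  obtain V un u where seq: "\<forall>n::nat. finite (V n) \<and> (\<forall>x. x \<notin> V n \<longrightarrow> un n x = 0) \<and>
      (\<forall>x\<in>V n. DJ \<epsilon> (un n) x = 0) \<and> (\<forall>x. un n x \<ge> 0) \<and> Q (V n) (un n) \<le> K \<and> r\<^sup>2 / 8 \<le> J (V n) \<epsilon> (un n)"
    and lim: "\<forall>x. (\<lambda>n. un n x) \<longlonglongrightarrow> u x" and sol: "solves_on U \<epsilon> u"
    using exhaustion_limit[OF U \<epsilon>(1), of K "\<lambda>S u. r\<^sup>2 / 8 \<le> J S \<epsilon> u", OF K]
    by (elim exE conjE) (rule that)
  have V: "finite (V n)" "x \<notin> V n \<Longrightarrow> un n x = 0" and crit: "x \<in> V n \<Longrightarrow> DJ \<epsilon> (un n) x = 0"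
    and nonneg: "un n x \<ge> 0" and Q: "Q (V n) (un n) \<le> K" and level: "r\<^sup>2 / 8 \<le> J (V n) \<epsilon> (un n)" for n x
    using seq by blast+
  have mh: "\<mu>min * h0 > 0" using \<mu>min(1) h0(1) by simp
  have "Q (V 0) (un 0) \<ge> 0" by (rule Q_nonneg[OF V(1)]) (rule V(2))
  then have K0: "0 \<le> K" using Q[of 0] by linarith
  define M where "M = sqrt (K / (\<mu>min * h0)) + 1"
  have un_le: "un n x \<le> M" for n x
  proof -
    have "\<mu>min * h0 * (un n x)\<^sup>2 \<le> K"
      using le_Q_pointwise[of "V n" "un n" x] V Q[of n] by fastforce
    then have "(un n x)\<^sup>2 \<le> K / (\<mu>min * h0)" using mh by (simp add: field_simps)
    then have "un n x \<le> sqrt (K / (\<mu>min * h0))" by (rule real_le_rsqrt)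
    then show ?thesis by (simp add: M_def)
  qed
  have "M > 0" using K0 mh by (simp add: M_def add_nonneg_pos)
  then obtain A0 where A0: "\<forall>x. \<forall>s\<in>{0..M}. f x s \<le> A0" using f_bound by blast
  define A where "A = max A0 0"
  have \<Phi>_le: "\<Phi> x (un n x) \<le> A / 2 * (\<mu> x * un n x)" for n x
  proof -
    have "f x (un n x) \<le> A" using A0 nonneg un_le by (auto simp: A_def le_max_iff_disj)
    then have "un n x * f x (un n x) \<le> un n x * A" using nonneg by (intro mult_left_mono) auto
    then have "un n x * f x (un n x) / 2 - F x (un n x) \<le> un n x * A / 2"
      using F_nonneg[of x "un n x"] by linarith
    then have "\<Phi> x (un n x) \<le> \<mu> x * (un n x * A / 2)"
      unfolding \<Phi>_def using \<mu>_pos[of x] by (intro mult_left_mono) auto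
    then show ?thesis by (simp add: ac_simps)
  qed
  define b where "b = A * sqrt K"
  have b: "b \<ge> 0" using K0 by (simp add: b_def A_def)
  \<comment> \<open>Makes \<open>A / 2 * sqrt e * sqrt K\<close> at most
    \<open>r\<^sup>2 / 32\<close>; \<open>b + 1\<close> avoids dividing by 0.\<close>
  define e where "e = (r\<^sup>2 / (16 * (b + 1)))\<^sup>2"
  have "r\<^sup>2 / (16 * (b + 1)) > 0" using small_radius_pos[OF r] b by (intro divide_pos_pos) auto
  then have e: "e > 0" "sqrt e = r\<^sup>2 / (16 * (b + 1))"
    unfolding e_def by (rule zero_less_power, intro real_sqrt_unique less_imp_le refl)
  obtain T where T: "finite T" "\<forall>S. finite S \<longrightarrow> S \<inter> T = {} \<longrightarrow> (\<Sum>x\<in>S. \<mu> x / h x) \<le> e"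
    using tail_small[OF e(1)] by blast
  have "r\<^sup>2 * 3 / 32 \<le> (\<Sum>x\<in>T. \<Phi> x (un n x))" for n
  proof -
    have "0 \<le> \<epsilon> / 2 * (\<Sum>x\<in>V n. \<mu> x * g x * un n x)"
      using \<epsilon>(1) nonneg g_nonneg \<mu>_pos by (intro mult_nonneg_nonneg sum_nonneg) (auto simp: less_imp_le)
    then have "r\<^sup>2 / 8 \<le> (\<Sum>x\<in>V n. \<Phi> x (un n x))"
      using level[of n] critical_J[of "V n" \<epsilon> "un n"] crit[of _ n] by simp
    also have "\<dots> = (\<Sum>x\<in>V n \<inter> T. \<Phi> x (un n x)) + (\<Sum>x\<in>V n - T. \<Phi> x (un n x))"
      by (rule sum.Int_Diff[OF V(1)])
    also have "(\<Sum>x\<in>V n \<inter> T. \<Phi> x (un n x)) \<le> (\<Sum>x\<in>T. \<Phi> x (un n x))"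
      using T(1) \<Phi>_nonneg by (intro sum_mono2) auto
    also have "(\<Sum>x\<in>V n - T. \<Phi> x (un n x)) \<le> A / 2 * (\<Sum>x\<in>V n - T. \<mu> x * un n x)"
      unfolding sum_distrib_left by (intro sum_mono \<Phi>_le)
    also have "\<dots> \<le> A / 2 * (sqrt e * sqrt K)"
    proof (rule mult_left_mono)
      have "(\<Sum>x\<in>V n - T. \<mu> x * un n x) \<le> sqrt (\<Sum>x\<in>V n - T. \<mu> x / h x) * sqrt (Q (V n) (un n))"
        using V by (intro L1_le_Q) auto
      also have "\<dots> \<le> sqrt e * sqrt K"
        using T(2)[rule_format, of "V n - T"] V(1)[of n] Q[of n] e(1) Q_nonneg[of "V n" "un n", OF V]
        by (intro mult_mono) auto
      finally show "(\<Sum>x\<in>V n - T. \<mu> x * un n x) \<le> sqrt e * sqrt K" .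
    qed (simp add: A_def)
    also have "A / 2 * (sqrt e * sqrt K) = b * sqrt e / 2" by (simp add: b_def)
    also have "\<dots> = b / (b + 1) * (r\<^sup>2 / 32)" unfolding e(2) by simp
    also have "\<dots> \<le> 1 * (r\<^sup>2 / 32)" using b by (intro mult_right_mono) (auto simp: field_simps)
    finally show ?thesis by simp
  qed
  moreover have "(\<lambda>n. \<Sum>x\<in>T. \<Phi> x (un n x)) \<longlonglongrightarrow> (\<Sum>x\<in>T. \<Phi> x (u x))"
    by (intro tendsto_sum \<Phi>_tendsto lim[rule_format])
  ultimately have "r\<^sup>2 * 3 / 32 \<le> (\<Sum>x\<in>T. \<Phi> x (u x))"
    by (intro LIMSEQ_le_const) auto
  then show ?thesis using that sol T(1) by blast
qed

text \<open>At the minimisers a level of at most 0 bounds the sum of \<open>\<Phi>\<close> by half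
  the linear term, hence by \<open>r\<^sup>2 / 16\<close>. As \<open>\<Phi>\<close> is nonnegative,
  this passes to finite partial sums and to the limit.\<close>

lemma small_solution:
  assumes r: "small_radius r"
    and \<epsilon>: "\<epsilon> \<ge> 0" "\<epsilon> * Cg \<le> r / 8" and U: "x0 \<in> U"
  shows "\<exists>u. solves_on U \<epsilon> u \<and> (\<forall>T. finite T \<longrightarrow> (\<Sum>x\<in>T. \<Phi> x (u x)) \<le> r\<^sup>2 / 16)"
proof -
  have "\<forall>S. finite S \<longrightarrow> x0 \<in> S \<longrightarrow> (\<exists>u. (\<forall>x. x \<notin> S \<longrightarrow> u x = 0) \<and>
      (\<forall>x\<in>S. DJ \<epsilon> u x = 0) \<and> Q S u \<le> r\<^sup>2 \<and> J S \<epsilon> u \<le> 0)"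
    by (intro allI impI local_min_critical[OF r \<epsilon>])
  from exhaustion_limit[OF U \<epsilon>(1) this]
  obtain V un u where seq: "\<forall>n::nat. finite (V n) \<and> (\<forall>x. x \<notin> V n \<longrightarrow> un n x = 0) \<and>
      (\<forall>x\<in>V n. DJ \<epsilon> (un n) x = 0) \<and> (\<forall>x. un n x \<ge> 0) \<and> Q (V n) (un n) \<le> r\<^sup>2 \<and> J (V n) \<epsilon> (un n) \<le> 0"
    and lim: "\<forall>x. (\<lambda>n. un n x) \<longlonglongrightarrow> u x" and sol: "solves_on U \<epsilon> u"
    by (elim exE conjE) (rule that)
  have V: "finite (V n)" "x \<notin> V n \<Longrightarrow> un n x = 0" and crit: "x \<in> V n \<Longrightarrow> DJ \<epsilon> (un n) x = 0"
    and Q: "Q (V n) (un n) \<le> r\<^sup>2" and level: "J (V n) \<epsilon> (un n) \<le> 0" for n x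
    using seq by blast+
  have "(\<Sum>x\<in>T. \<Phi> x (u x)) \<le> r\<^sup>2 / 16" if T: "finite T" for T
  proof -
    have "(\<Sum>x\<in>T. \<Phi> x (un n x)) \<le> r\<^sup>2 / 16" for n
    proof -
      have "(\<Sum>x\<in>T. \<Phi> x (un n x)) = (\<Sum>x\<in>T \<inter> V n. \<Phi> x (un n x))"
        using T V(2) \<Phi>_0 by (intro sum.mono_neutral_right) auto
      also have "\<dots> \<le> (\<Sum>x\<in>V n. \<Phi> x (un n x))"
        using V(1) \<Phi>_nonneg by (intro sum_mono2) auto
      also have "\<dots> \<le> \<epsilon> / 2 * (\<Sum>x\<in>V n. \<mu> x * g x * un n x)"
        using level[of n] critical_J[of "V n" \<epsilon> "un n"] crit[of _ n] by simp
      also have "\<dots> \<le> \<epsilon> / 2 * (Cg * sqrt (Q (V n) (un n)))"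
        using g_bound[of "V n" "un n"] V \<epsilon>(1) by (intro mult_left_mono) auto
      also have "\<dots> \<le> \<epsilon> / 2 * (Cg * r)"
        using Q[of n] small_radius_pos[OF r] \<epsilon>(1) Cg by (intro mult_left_mono) (auto intro: real_le_lsqrt)
      also have "\<dots> \<le> r / 8 * (r / 2)"
        using mult_right_mono[OF \<epsilon>(2), of "r / 2"] small_radius_pos[OF r] by (simp add: ac_simps)
      finally show ?thesis by (simp add: power2_eq_square)
    qed
    moreover have "(\<lambda>n. \<Sum>x\<in>T. \<Phi> x (un n x)) \<longlonglongrightarrow> (\<Sum>x\<in>T. \<Phi> x (u x))"
      by (intro tendsto_sum \<Phi>_tendsto lim[rule_format])
    ultimately show ?thesis by (intro LIMSEQ_le_const2) auto
  qed
  then show ?thesis using sol by blast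
qed

subsection \<open>Positivity and gluing of components\<close>

text \<open>At a zero of a nonnegative solution the equation equates the nonnegative term with
  \<open>g\<close> and minus a weighted sum of the neighbouring values; both must vanish.\<close>

lemma zero_propagates:
  assumes "solves_on U \<epsilon> u" "\<epsilon> \<ge> 0" "x \<in> U" "u x = 0"
  shows "\<epsilon> * g x = 0" "E x y \<Longrightarrow> u y = 0"
proof -
  have nn: "0 \<le> w x y * u y" if "E x y" for y
    using assms(1) w_pos[OF that] by (simp add: solves_on_def)
  have "L u x = f x (u x) + \<epsilon> * g x" using assms(1,3) by (simp add: solves_on_def)
  then have eq: "\<mu> x * (\<epsilon> * g x) = \<mu> x * L u x" using assms(4) f_neg[of 0 x] by simp
  also have "\<dots> = - (\<Sum>y | E x y. w x y * u y)" unfolding \<mu>_L assms(4) by (simp add: sum_negf)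
  finally have eq: "\<mu> x * (\<epsilon> * g x) = - (\<Sum>y | E x y. w x y * u y)" .
  have "0 \<le> \<mu> x * (\<epsilon> * g x)"
    using assms(2) g_nonneg[of x] \<mu>_pos[of x] by simp
  moreover have "0 \<le> (\<Sum>y | E x y. w x y * u y)" using nn by (intro sum_nonneg) auto
  ultimately have z: "\<mu> x * (\<epsilon> * g x) = 0" "(\<Sum>y | E x y. w x y * u y) = 0" using eq by linarith+
  then show "\<epsilon> * g x = 0" using \<mu>_pos[of x] by simp
  assume "E x y"
  moreover have "\<forall>y\<in>{y. E x y}. w x y * u y = 0"
    using z(2) nn sum_nonneg_eq_0_iff[OF finite_nbrs[of x], of "\<lambda>y. w x y * u y"] by simp
  ultimately show "u y = 0" using w_pos[of x y] by fastforce
qed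

lemma positive_on_component:
  assumes sol: "solves_on (component x0) \<epsilon> u" "\<epsilon> \<ge> 0" and nz: "y \<in> component x0" "u y \<noteq> 0"
    and z: "z \<in> component x0"
  shows "u z > 0"
proof (rule ccontr)
  assume "\<not> u z > 0"
  moreover have "u z \<ge> 0" using sol(1) by (simp add: solves_on_def)
  ultimately have "u z = 0" by simp
  have "E\<^sup>*\<^sup>* z y" using component_eq[OF z] nz(1) unfolding component_def by blast
  then have "u y = 0 \<and> y \<in> component x0"
    by (induction rule: rtranclp_induct)
       (use \<open>u z = 0\<close> z zero_propagates(2)[OF sol] component_step in blast)+
  then show False using nz(2) by simp
qed

lemma two_solutions:
  assumes r: "small_radius r" and \<epsilon>: "\<epsilon> > 0" "\<epsilon> * Cg \<le> r / 8" and g: "g x1 \<noteq> 0"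
  shows "\<exists>u v. u \<noteq> v \<and> (\<forall>x. u x > 0 \<and> L u x = f x (u x) + \<epsilon> * g x) \<and>
    (\<forall>x. v x > 0 \<and> L v x = f x (v x) + \<epsilon> * g x)"
proof -
  have \<epsilon>0: "\<epsilon> \<ge> 0" using \<epsilon>(1) by simp
  have rp: "r\<^sup>2 > 0" using small_radius_pos[OF r] by simp
  define good where "good C u \<longleftrightarrow> solves_on C \<epsilon> u \<and> (\<forall>y\<in>C. u y > 0)" for C u
  have mp: "\<exists>u. good (component x) u \<and> (\<exists>T. finite T \<and> r\<^sup>2 * 3 / 32 \<le> (\<Sum>x\<in>T. \<Phi> x (u x)))" for x
  proof -
    obtain u T where u: "solves_on (component x) \<epsilon> u" "finite T" "r\<^sup>2 * 3 / 32 \<le> (\<Sum>x\<in>T. \<Phi> x (u x))"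
      by (rule mountain_pass_solution[OF r \<epsilon>0 \<epsilon>(2) component_refl])
    have "\<exists>y. u y \<noteq> 0"
    proof (rule ccontr)
      assume "\<nexists>y. u y \<noteq> 0"
      then show False using u(3) \<Phi>_0 rp by simp
    qed
    then obtain y where y: "u y \<noteq> 0" by blast
    then have "y \<in> component x" using u(1) by (auto simp: solves_on_def)
    then show ?thesis
      using u positive_on_component[OF u(1) \<epsilon>0 _ y] by (auto simp: good_def)
  qed
  \<comment> \<open>The choice depends on the component as a set, so all vertices of one component
    use the same solution.\<close>
  define s where "s C = (SOME u. good C u)" for C
  have s: "good (component x) (s (component x))" for x
    using mp[of x] unfolding s_def by (metis someI_ex)
  define glue where "glue p x = (if x \<in> component x1 then p x else s (component x) x)" for p x
  have glue: "glue p x > 0 \<and> L (glue p) x = f x (glue p x) + \<epsilon> * g x" if p: "good (component x1) p" for p x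
  proof -
    define q where "q = (if x \<in> component x1 then p else s (component x))"
    have "good (component x) q"
      using p s component_eq[of x x1] by (auto simp: q_def)
    then have q: "q x > 0" "L q x = f x (q x) + \<epsilon> * g x"
      using component_refl[of x] by (auto simp: good_def solves_on_def)
    have eq: "glue p y = q y" if "y \<in> component x" for y
      using component_eq[OF that] component_eq[of x x1] component_eq[of y x1]
        component_refl[of x] component_refl[of y] by (auto simp: glue_def q_def)
    have "L (glue p) x = L q x"
      using eq component_refl[of x] component_step[OF component_refl] by (intro L_cong) auto
    then show ?thesis using q eq[OF component_refl] by simp
  qed
  obtain p T where p: "good (component x1) p" "finite T" "r\<^sup>2 * 3 / 32 \<le> (\<Sum>x\<in>T. \<Phi> x (p x))"
    using mp[of x1] by blast
  obtain q where q: "solves_on (component x1) \<epsilon> q" "\<forall>T. finite T \<longrightarrow> (\<Sum>x\<in>T. \<Phi> x (q x)) \<le> r\<^sup>2 / 16"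
    using small_solution[OF r \<epsilon>0 \<epsilon>(2) component_refl] by blast
  \<comment> \<open>The small solution could vanish on a component without source; here
    \<open>g x1\<close> prevents this.\<close>
  have "q x1 \<noteq> 0" using zero_propagates(1)[OF q(1) \<epsilon>0 component_refl] \<epsilon>(1) g by auto
  then have gq: "good (component x1) q"
    using q(1) positive_on_component[OF q(1) \<epsilon>0 component_refl] by (auto simp: good_def)
  \<comment> \<open>Since \<open>p\<close> and \<open>q\<close> vanish off the component of
    \<open>x1\<close>, equal gluings would give \<open>p = q\<close>, against
    \<open>3 / 32 > 1 / 16\<close>.\<close>
  have "glue p \<noteq> glue q"
  proof
    assume eq: "glue p = glue q"
    have "p x = q x" for x
    proof (cases "x \<in> component x1")
      case True
      then show ?thesis using fun_cong[OF eq, of x] by (simp add: glue_def)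
    next
      case False
      then show ?thesis using p(1) gq by (simp add: good_def solves_on_def)
    qed
    then have "(\<Sum>x\<in>T. \<Phi> x (p x)) \<le> r\<^sup>2 / 16" using q(2) p(2) by simp
    then show False using p(3) rp by linarith
  qed
  then show ?thesis using glue p(1) gq by (intro exI[of _ "glue p"] exI[of _ "glue q"]) auto
qed

end

section \<open>Truncating the nonlinearity and concluding\<close>

lemma LBINT_primitive_deriv:
  fixes f :: "real \<Rightarrow> real"
  assumes f: "continuous_on UNIV f"
  shows "((\<lambda>s. LBINT t=0..s. f t) has_real_derivative f s) (at s)"
proof -
  \<comment> \<open>An interval that contains 0 and has \<open>s\<close> in its interior, so the
    derivative is two-sided.\<close>
  let ?a = "min 0 s - 1" and ?b = "max 0 s + 1"
  have "((\<lambda>s. LBINT t=ereal 0..s. f t) has_vector_derivative f s) (at s within {?a..?b})"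
    using f by (intro interval_integral_FTC2) (auto intro: continuous_on_subset)
  moreover have "at s within {?a..?b} = at s"
    by (rule at_within_interior) auto
  ultimately show ?thesis
    by (simp add: has_real_derivative_iff_has_vector_derivative zero_ereal_def)
qed

theorem theorem3:
  fixes E :: "'v \<Rightarrow> 'v \<Rightarrow> bool"
    and w :: "'v \<Rightarrow> 'v \<Rightarrow> real"
    and \<mu> h g :: "'v \<Rightarrow> real"
    and f :: "'v \<Rightarrow> real \<Rightarrow> real"
    and \<mu>min h0 \<theta> :: real
  assumes graph: "locally_finite_graph E"
    and w_pos: "\<And>x y. E x y \<Longrightarrow> w x y > 0"
    and w_sym: "\<And>x y. E x y \<Longrightarrow> w x y = w y x"
    and \<mu>min: "\<mu>min > 0" "\<And>x. \<mu> x \<ge> \<mu>min"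
    and h0: "h0 > 0" "\<And>x. h x \<ge> h0"
    and h_inv: "in_L1 \<mu> (\<lambda>x. 1 / h x)"
    and f_cont: "\<And>x. continuous_on UNIV (f x)"
    and f_zero: "\<And>x. f x 0 = 0"
    and f_bound: "\<And>M. M > 0 \<Longrightarrow> \<exists>A. \<forall>x. \<forall>s\<in>{0..M}. f x s \<le> A"
    and \<theta>: "\<theta> > 2"
    and f_AR: "\<And>x s. s > 0 \<Longrightarrow>
        0 < \<theta> * primitive f x s \<and> \<theta> * primitive f x s \<le> s * f x s"
    and f_limsup: "\<And>x. Limsup (at_right 0) (\<lambda>s. ereal (2 * primitive f x s / s\<^sup>2))
        < ereal (lambda1 E w \<mu> h)"
    and g_dual: "in_H_dual E w \<mu> h g"
    and g_nonneg: "\<And>x. g x \<ge> 0"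
    and g_nonzero: "\<exists>x. g x \<noteq> 0"
  shows "\<exists>\<epsilon>0>0. \<forall>\<epsilon>. 0 < \<epsilon> \<and> \<epsilon> < \<epsilon>0 \<longrightarrow>
           (\<exists>u v. u \<noteq> v \<and> is_positive_solution E w \<mu> h f g \<epsilon> u
                        \<and> is_positive_solution E w \<mu> h f g \<epsilon> v)"
proof -
  interpret weighted_graph E w \<mu> h \<mu>min h0
    by unfold_locales (use graph w_pos w_sym \<mu>min h0 in auto)
  \<comment> \<open>As \<open>f x 0 = 0\<close>, this is continuous and vanishes at negative
    arguments; it agrees with \<open>f\<close> at the positive values of the solutions
    found.\<close>
  define fp where "fp x s = f x (max 0 s)" for x s
  define Fp where "Fp x s = (LBINT t=0..s. fp x t)" for x and s :: real
  obtain C where C: "\<And>\<phi>. \<phi> \<in> Cc \<Longrightarrow> \<bar>vint \<mu> (\<lambda>x. g x * \<phi> x)\<bar> \<le> C * H_norm E w \<mu> h \<phi>"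
    using g_dual unfolding in_H_dual_def by blast
  \<comment> \<open>The dual bound \<open>C\<close> may fail to be positive; enlarging it is
    harmless and permits division by \<open>Cg\<close>.\<close>
  define Cg where "Cg = max C 1"
  have fp_cont: "continuous_on UNIV (fp x)" for x
    unfolding fp_def by (rule continuous_on_compose2[OF f_cont]) (auto intro!: continuous_intros)
  have Fp_pos: "Fp x s = primitive f x s" if "s > 0" for x s
    unfolding Fp_def primitive_def
    by (rule interval_integral_cong) (use that in \<open>auto simp: fp_def einterval_def min_def\<close>)
  interpret superlinear_problem E w \<mu> h \<mu>min h0 fp Fp g \<theta> Cg
  proof
    show "continuous_on UNIV (fp x)" for x by (rule fp_cont)
    show "(Fp x has_real_derivative fp x s) (at s)" for x s
      unfolding Fp_def by (rule LBINT_primitive_deriv[OF fp_cont])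
    show "fp x s = 0" if "s \<le> 0" for x s using that f_zero by (simp add: fp_def)
    show "Fp x s = 0" if "s \<le> 0" for x s
    proof -
      have "Fp x s = (LBINT t=0..s. 0)"
        unfolding Fp_def
        by (rule interval_integral_cong)
          (use that f_zero in \<open>auto simp: fp_def einterval_def min_def max_def zero_ereal_def split: if_splits\<close>)
      then show ?thesis by simp
    qed
    show "\<exists>A. \<forall>x. \<forall>s\<in>{0..M}. fp x s \<le> A" if "M > 0" for M
      using f_bound[OF that] by (auto simp: fp_def)
    show "0 < Fp x s" if "s > 0" for x s
      using f_AR[OF that, of x] Fp_pos[OF that] \<theta> by (simp add: zero_less_mult_iff)
    show "\<theta> * Fp x s \<le> s * fp x s" if "s > 0" for x s
      using f_AR[OF that, of x] Fp_pos[OF that] that by (simp add: fp_def)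
    show "(\<lambda>x. \<mu> x / h x) summable_on UNIV"
      using h_inv \<mu>_pos h_pos by (simp add: in_L1_def abs_of_pos)
    show "Cg > 0" by (simp add: Cg_def)
    show "(\<Sum>x\<in>S. \<mu> x * g x * u x) \<le> Cg * sqrt (Q S u)"
      if S: "finite S" "\<And>x. x \<notin> S \<Longrightarrow> u x = 0" for S u
    proof -
      have "finite {x. u x \<noteq> 0}" by (rule finite_subset[OF _ S(1)]) (use S(2) in auto)
      then have "\<bar>vint \<mu> (\<lambda>x. g x * u x)\<bar> \<le> C * sqrt (Q S u)"
        using C[of u] H_norm_eq_Q[OF S] by (simp add: Cc_def)
      also have "\<dots> \<le> Cg * sqrt (Q S u)"
        using Q_nonneg[OF S] by (intro mult_right_mono) (auto simp: Cg_def)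
      finally have "vint \<mu> (\<lambda>x. g x * u x) \<le> Cg * sqrt (Q S u)" by linarith
      moreover have "vint \<mu> (\<lambda>x. g x * u x) = infsum (\<lambda>x. \<mu> x * g x * u x) S"
        unfolding vint_def using S(2) by (intro infsum_cong_neutral) auto
      ultimately show ?thesis using S(1) by simp
    qed
  qed (use \<theta> g_nonneg in auto)
  obtain r where r: "small_radius r" by (rule small_radius_exists)
  obtain x1 where x1: "g x1 \<noteq> 0" using g_nonzero by blast
  show ?thesis
  \<comment> \<open>This is the smallness of \<epsilon> under which the ring stays at height
    \<open>r\<^sup>2 / 8\<close>.\<close>
  proof (intro exI[of _ "r / (8 * Cg)"] conjI allI impI)
    show "0 < r / (8 * Cg)" using small_radius_pos[OF r] Cg by simp
    fix \<epsilon> assume \<epsilon>: "0 < \<epsilon> \<and> \<epsilon> < r / (8 * Cg)"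
    then have "\<epsilon> * Cg \<le> r / 8" using Cg by (simp add: field_simps)
    then obtain u v where uv: "u \<noteq> v" "\<forall>x. u x > 0 \<and> L u x = fp x (u x) + \<epsilon> * g x"
      "\<forall>x. v x > 0 \<and> L v x = fp x (v x) + \<epsilon> * g x"
      using two_solutions[OF r _ _ x1] \<epsilon> by blast
    then have "is_positive_solution E w \<mu> h f g \<epsilon> u" "is_positive_solution E w \<mu> h f g \<epsilon> v"
      unfolding is_positive_solution_def by (auto simp: L_def fp_def max_def less_imp_le)
    then show "\<exists>u v. u \<noteq> v \<and> is_positive_solution E w \<mu> h f g \<epsilon> u \<and> is_positive_solution E w \<mu> h f g \<epsilon> v"
      using uv(1) by blast
  qed
qed

end
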